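(* Let $M$ be a smooth manifold of dimension $m$. The classical variational problem specified by the Einstein--Hilbert Lagrangian density $\mathcal L_{EH}$ on $J^2\tau_\Sigma$ and the variational problem $\big(J^1\tau_\Sigma,\mathcal L_{EH}^{(1)},\mathcal I^\Sigma_{\mathrm{con}}\big)$ have the same set of extremals.
   Context: Setting. $\tau\colon LM\to M$ is the bundle of linear frames $u=(X_1,\dots,X_m)$ of $M$; $J^1\tau$ its first jet bundle with projections $\tau_{10}\colon J^1\tau\to LM$, $\tau_1\colon J^1\tau\to M$. Einstein summation is used. $\eta=\mathrm{diag}(-1,1,\dots,1)$ with entries $\eta_{ij}$ and inverse entries $\eta^{ij}$; $K=\{A\in GL(m):\eta_{ij}A^i_kA^j_l=\eta_{kl}\}$; $p_K^{LM}\colon LM\to\Sigma:=LM/K$ and $\tau_\Sigma\colon\Sigma\to M$ are the quotient map and the induced bundle; via $[X_1,\dots,X_m]_K\mapsto\eta^{ij}X_i\otimes X_j$, $\Sigma$ is the bundle of metrics of signature $\eta$ on $M$. On $J^1\tau$: $\theta=(\theta^i)$ is the pullback by $\tau_{10}$ of the tautological $\mathbb R^m$-valued form of $LM$; the Cartan form $T_{j^1_xs}\tau_{10}-T_xs\circ T_{j^1_xs}\tau_1$, with values in $V\tau\simeq LM\times\mathfrak{gl}(m)$, defines a $\mathfrak{gl}(m)$-valued 1-form $\omega=(\omega^i_j)$, a principal connection form on $J^1\tau\to J^1\tau/GL(m)$; $\Omega^i_j=d\omega^i_j+\omega^i_k\wedge\omega^k_j$ is its curvature; $\theta_0=\theta^1\wedge\cdots\wedge\theta^m$;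 $\theta_{ik}|_{j^1_xs}=X_i\lrcorner(X_k\lrcorner\theta_0)$ where $s(x)=(X_1,\dots,X_m)$; $\mathcal L_{PG}=\eta^{ip}\theta_{ik}\wedge\Omega^k_p$. $\mathcal T_0\subset J^1\tau$ is the submanifold where the torsion $d\theta^j+\omega^j_k\wedge\theta^k$ vanishes (in induced coordinates $(x^\mu,e^\mu_k,e^\mu_{k\sigma})$: $e^k_\mu e^\sigma_{k\nu}=e^k_\nu e^\sigma_{k\mu}$, with $(e^k_\mu)$ the inverse matrix of $(e^\mu_k)$). $\mathcal L^{(1)}_{EH}$ is the unique 2-horizontal $m$-form on $J^1\tau_\Sigma$ (2-horizontal: contraction with any two vectors vertical over $M$ is zero) whose pullback by the map $\mathcal T_0\to J^1\tau_\Sigma$, $j^1_xs\mapsto j^1_x(p_K^{LM}\circ s)$, equals the pullback of $\mathcal L_{PG}$ to $\mathcal T_0$. $\mathcal L_{EH}\colon J^2\tau_\Sigma\to\wedge^m(T^*M)$ is the Einstein--Hilbert Lagrangian density, given essentially by the scalar curvature of the Levi-Civita connection associated to a metric; it is regarded as a horizontal $m$-form on $J^2\tau_\Sigma$. $\mathcal I^\Sigma_{\mathrm{con}}$ is the exterior differential system of the contact structure; its integral sections are the holonomic sections. The two actions are therefore $g\mapsto\int(j^2g)^*\mathcal L_{EH}$ and $g\mapsto\int(j^1g)^*\mathcal L^{(1)}_{EH}$, for sections $g\colon M\to\Sigma$ of $\tau_\Sigma$, and the sets of extremals are compared as sets of such metrics $g$. A section $g$ is an extremal of an action if, for every compact $C\subset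 M$, the derivative at $t=0$ of the action over $C$ vanishes along every smooth variation $g_t$ of $g$ through sections of $\tau_\Sigma$ with $g_0=g$ and $g_t=g$ outside $C$.
   Formalization: Since K contains elements of determinant −1, which reverse the sign of L_PG, no ordinary m-form L_EH^(1) exists for m ≥ 2; here it is an orientation-twisted m-form whose pullback to T_0 is sgn(det e)·L_PG, which is the usual one for oriented M and positive frames. *)

theory Defs
  imports "HOL-Analysis.Analysis" "HOL-Combinatorics.Permutations"
begin

section \<open>Smooth maps and differential forms in Euclidean spaces\<close>

text \<open>Used on open sets only.\<close>

primrec Ck_on :: "nat \<Rightarrow> 'e::euclidean_space set \<Rightarrow> ('e \<Rightarrow> 'f::real_normed_vector) \<Rightarrow> bool" where
  "Ck_on 0 S f \<longleftrightarrow> continuous_on S f"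
| "Ck_on (Suc n) S f \<longleftrightarrow>
     (\<forall>x\<in>S. f differentiable (at x)) \<and> (\<forall>v. Ck_on n S (\<lambda>x. frechet_derivative f (at x) v))"

definition smooth_on :: "'e::euclidean_space set \<Rightarrow> ('e \<Rightarrow> 'f::real_normed_vector) \<Rightarrow> bool" where
  "smooth_on S f \<longleftrightarrow> (\<forall>n. Ck_on n S f)"

text \<open>The velocities of curves in \<open>S\<close> through \<open>p\<close>; for an embedded submanifold \<open>S\<close> this is the
  tangent space.\<close>

definition tangent_vectors :: "'e::euclidean_space set \<Rightarrow> 'e \<Rightarrow> 'e set" where
  "tangent_vectors S p =
     {v. \<exists>\<gamma>. \<gamma> 0 = p \<and> (\<forall>\<^sub>F t in at 0. \<gamma> t \<in> S) \<and> (\<gamma> has_vector_derivative v) (at (0::real))}"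

text \<open>A form takes the list of its arguments; its degree \<open>k\<close> is carried separately, and only its
  values on lists of length \<open>k\<close> matter. Conventions:
  \<open>d\<alpha>(v,w) = D\<^sub>v \<alpha>(w) - D\<^sub>w \<alpha>(v)\<close> for constant \<open>v\<close>, \<open>w\<close>, and
  \<open>(\<alpha> \<and> \<beta>)(v,w) = \<alpha>(v)\<beta>(w) - \<alpha>(w)\<beta>(v)\<close> for 1-forms.\<close>

type_synonym 'e form = "'e \<Rightarrow> 'e list \<Rightarrow> real"

definition alternating_multilinear :: "nat \<Rightarrow> 'e::real_vector set \<Rightarrow> ('e list \<Rightarrow> real) \<Rightarrow> bool" where
  "alternating_multilinear k V a \<longleftrightarrow>
     (\<forall>us ws v w r s. set us \<subseteq> V \<and> set ws \<subseteq> V \<and> v \<in> V \<and> w \<in> V \<and> length us + 1 + length ws = k \<longrightarrow>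
        a (us @ (r *\<^sub>R v + s *\<^sub>R w) # ws) = r * a (us @ v # ws) + s * a (us @ w # ws)) \<and>
     (\<forall>vs. set vs \<subseteq> V \<and> length vs = k \<and> \<not> distinct vs \<longrightarrow> a vs = 0)"

text \<open>Smooth \<open>k\<close>-forms on an embedded submanifold \<open>S\<close> of a Euclidean space. Values on vectors
  that are not tangent to \<open>S\<close> are irrelevant.\<close>

definition differential_form :: "nat \<Rightarrow> 'e::euclidean_space set \<Rightarrow> 'e form \<Rightarrow> bool" where
  "differential_form k S \<alpha> \<longleftrightarrow>
     (\<forall>p\<in>S. alternating_multilinear k (tangent_vectors S p) (\<alpha> p)) \<and>
     (\<exists>T \<beta>. open T \<and> S \<subseteq> T \<and> (\<forall>vs. length vs = k \<longrightarrow> smooth_on T (\<lambda>p. \<beta> p vs)) \<and>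
        (\<forall>p\<in>S. \<forall>vs. length vs = k \<and> set vs \<subseteq> tangent_vectors S p \<longrightarrow> \<alpha> p vs = \<beta> p vs))"

definition pullback :: "('d::euclidean_space \<Rightarrow> 'e::euclidean_space) \<Rightarrow> 'e form \<Rightarrow> 'd form" where
  "pullback F \<alpha> x vs = \<alpha> (F x) (map (frechet_derivative F (at x)) vs)"

definition ext_deriv :: "'e::euclidean_space form \<Rightarrow> 'e form" where
  "ext_deriv \<alpha> x vs =
     (\<Sum>i<length vs. (-1) ^ i *
        frechet_derivative (\<lambda>y. \<alpha> y (take i vs @ drop (Suc i) vs)) (at x) (vs ! i))"

text \<open>Exterior product of a \<open>p\<close>-form and a \<open>q\<close>-form.\<close>

definition wedge :: "nat \<Rightarrow> nat \<Rightarrow> 'e form \<Rightarrow> 'e form \<Rightarrow> 'e form" where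
  "wedge p q \<alpha> \<beta> x vs =
     (\<Sum>\<pi> | \<pi> permutes {..<p + q}. of_int (sign \<pi>) *
        \<alpha> x (map (\<lambda>i. vs ! \<pi> i) [0..<p]) * \<beta> x (map (\<lambda>i. vs ! \<pi> i) [p..<p + q]))
     / (fact p * fact q)"

text \<open>Exterior product of a list of 1-forms. It vanishes on lists of the wrong length, so that
  contracting it too often gives 0 (this matters for \<open>theta2\<close> below in dimension one).\<close>

definition wedge_list :: "'e form list \<Rightarrow> 'e form" where
  "wedge_list \<alpha>s x vs =
     (if length vs = length \<alpha>s
      then \<Sum>\<pi> | \<pi> permutes {..<length vs}. of_int (sign \<pi>) * (\<Prod>i<length vs. (\<alpha>s ! i) x [vs ! \<pi> i])
      else 0)"

definition contract :: "('e \<Rightarrow> 'e) \<Rightarrow> 'e form \<Rightarrow> 'e form" where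
  "contract Y \<alpha> x vs = \<alpha> x (Y x # vs)"


section \<open>Smooth manifolds\<close>

text \<open>The dimension is \<open>CARD('m)\<close>; the linear order on the index type fixes the order of the
  coordinates.\<close>

type_synonym 'm coords = "real^'m"
type_synonym ('a, 'm) chart = "'a set \<times> ('a \<Rightarrow> 'm coords)"

definition chart_image :: "('a, 'm) chart \<Rightarrow> (real^'m) set" where
  "chart_image c = snd c ` fst c"

definition coord_change :: "('a, 'm) chart \<Rightarrow> ('a, 'm) chart \<Rightarrow> real^'m \<Rightarrow> real^'m" where
  "coord_change c c' = snd c' \<circ> inv_into (fst c) (snd c)"

definition smooth_manifold :: "'a topology \<Rightarrow> ('a, 'm::finite) chart set \<Rightarrow> bool" where
  "smooth_manifold X A \<longleftrightarrow>
     Hausdorff_space X \<and> second_countable X \<and> \<Union> (fst ` A) = topspace X \<and>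
     (\<forall>c\<in>A. openin X (fst c) \<and> open (chart_image c) \<and>
        homeomorphic_map (subtopology X (fst c)) (top_of_set (chart_image c)) (snd c)) \<and>
     (\<forall>c\<in>A. \<forall>c'\<in>A. smooth_on (snd c ` (fst c \<inter> fst c')) (coord_change c c'))"


section \<open>Jets in induced coordinates\<close>

text \<open>Over a chart, a bundle with typical fibre (contained in) \<open>'f\<close> is trivialised, and its first
  jet bundle has coordinates \<open>(x, f, z)\<close> with \<open>z $ \<sigma>\<close> the derivative of the fibre coordinates in
  direction \<open>\<sigma>\<close>; similarly \<open>(x, f, z, w)\<close> for the second jets.\<close>

type_synonym ('f, 'm) j1 = "(real^'m) \<times> 'f \<times> ('f^'m)"
type_synonym ('f, 'm) j2 = "(real^'m) \<times> 'f \<times> ('f^'m) \<times> ('f^'m^'m)"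

definition pd :: "'m::finite \<Rightarrow> (real^'m \<Rightarrow> 'f::real_normed_vector) \<Rightarrow> real^'m \<Rightarrow> 'f" where
  "pd \<sigma> s x = frechet_derivative s (at x) (axis \<sigma> 1)"

definition jet1 :: "(real^'m \<Rightarrow> 'f::euclidean_space) \<Rightarrow> real^'m \<Rightarrow> ('f, 'm::finite) j1" where
  "jet1 s x = (x, s x, \<chi> \<sigma>. pd \<sigma> s x)"

definition jet2 :: "(real^'m \<Rightarrow> 'f::euclidean_space) \<Rightarrow> real^'m \<Rightarrow> ('f, 'm::finite) j2" where
  "jet2 s x = (x, s x, \<chi> \<sigma>. pd \<sigma> s x, \<chi> \<sigma> \<nu>. pd \<sigma> (pd \<nu> s) x)"

text \<open>Polynomial local sections representing a given jet.\<close>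

definition jet1_rep :: "('f::euclidean_space, 'm::finite) j1 \<Rightarrow> real^'m \<Rightarrow> 'f" where
  "jet1_rep j y = (case j of (x, f, z) \<Rightarrow> f + (\<Sum>\<sigma>\<in>UNIV. (y - x) $ \<sigma> *\<^sub>R z $ \<sigma>))"

definition jet2_rep :: "('f::euclidean_space, 'm::finite) j2 \<Rightarrow> real^'m \<Rightarrow> 'f" where
  "jet2_rep j y = (case j of (x, f, z, w) \<Rightarrow>
     f + (\<Sum>\<sigma>\<in>UNIV. (y - x) $ \<sigma> *\<^sub>R z $ \<sigma>) +
     (1/2) *\<^sub>R (\<Sum>\<sigma>\<in>UNIV. \<Sum>\<nu>\<in>UNIV. ((y - x) $ \<sigma> * (y - x) $ \<nu>) *\<^sub>R w $ \<sigma> $ \<nu>))"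

text \<open>The first jets of local sections over \<open>D\<close> with values in the fibre \<open>F\<close>.\<close>

definition jet1_space :: "(real^'m::finite) set \<Rightarrow> 'f::euclidean_space set \<Rightarrow> ('f, 'm) j1 set" where
  "jet1_space D F =
     {jet1 s x | s x. \<exists>N. open N \<and> x \<in> N \<and> N \<subseteq> D \<and> smooth_on N s \<and> s ` N \<subseteq> F}"


section \<open>Frames, metrics, and the Palatini Lagrangian\<close>

text \<open>Frames \<open>u = (X\<^sub>k)\<close> are matrices \<open>e\<close> with \<open>e $ \<mu> $ k = e\<^sup>\<mu>\<^sub>k\<close>, i.e. \<open>X\<^sub>k\<close> is column \<open>k\<close>.
  Metrics are given by their contravariant components \<open>g\<^sup>\<mu>\<^sup>\<nu>\<close>, so that the projection of
  \<open>LM\<close> onto the quotient by \<open>K\<close> is \<open>(X\<^sub>k) \<mapsto> \<eta>\<^sup>i\<^sup>j X\<^sub>i \<otimes> X\<^sub>j\<close>.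
  The forms on the jet bundle of the frame bundle are natural, so each of them is given by the same
  formula in the induced coordinates of every chart.\<close>

type_synonym 'm mat = "real^'m^'m"

definition eta :: "'m::{finite,linorder} mat" where
  "eta = (\<chi> i j. if i = j then (if i = Min UNIV then -1 else 1) else 0)"

definition frames :: "'m::finite mat set" where
  "frames = {e. invertible e}"

definition frame_metric :: "'m::{finite,linorder} mat \<Rightarrow> 'm mat" where
  "frame_metric e = e ** matrix_inv eta ** transpose e"

definition metrics :: "'m::{finite,linorder} mat set" where
  "metrics = frame_metric ` frames"

definition J1_frames :: "('a, 'm::finite) chart \<Rightarrow> ('m mat, 'm) j1 set" where
  "J1_frames c = jet1_space (chart_image c) frames"

definition J1_metrics :: "('a, 'm::{finite,linorder}) chart \<Rightarrow> ('m mat, 'm) j1 set" where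
  "J1_metrics c = jet1_space (chart_image c) metrics"

abbreviation frame_of :: "('m mat, 'm::finite) j1 \<Rightarrow> 'm mat" where
  "frame_of p \<equiv> fst (snd p)"

definition theta :: "'m \<Rightarrow> ('m mat, 'm::finite) j1 form" where
  "theta i p vs = (matrix_inv (frame_of p) *v fst (vs ! 0)) $ i"

text \<open>\<open>T\<tau>\<^sub>1\<^sub>0(v) - Ts(T\<tau>\<^sub>1(v))\<close> at a 1-jet of \<open>s\<close>. Its base component vanishes; this is the
  fibre component \<open>de - z\<^sub>\<sigma> dx\<^sup>\<sigma>\<close>.\<close>

definition cartan :: "('m mat, 'm::finite) j1 \<Rightarrow> ('m mat, 'm) j1 \<Rightarrow> 'm mat" where
  "cartan p v = fst (snd v) - (\<Sum>\<sigma>\<in>UNIV. fst v $ \<sigma> *\<^sub>R snd (snd p) $ \<sigma>)"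

text \<open>The vertical vector at \<open>e\<close> corresponding to \<open>a\<close> in \<open>gl(m)\<close> is \<open>d/dt (e exp(t a)) = e a\<close>.\<close>

definition omega :: "'m \<Rightarrow> 'm \<Rightarrow> ('m mat, 'm::finite) j1 form" where
  "omega i j p vs = (matrix_inv (frame_of p) ** cartan p (vs ! 0)) $ i $ j"

definition Omega :: "'m \<Rightarrow> 'm \<Rightarrow> ('m mat, 'm::finite) j1 form" where
  "Omega i j p vs = ext_deriv (omega i j) p vs + (\<Sum>k\<in>UNIV. wedge 1 1 (omega i k) (omega k j) p vs)"

definition torsion :: "'m \<Rightarrow> ('m mat, 'm::finite) j1 form" where
  "torsion j p vs = ext_deriv (theta j) p vs + (\<Sum>k\<in>UNIV. wedge 1 1 (omega j k) (theta k) p vs)"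

definition T0 :: "('a, 'm::finite) chart \<Rightarrow> ('m mat, 'm) j1 set" where
  "T0 c = {p \<in> J1_frames c. \<forall>j v w. torsion j p [v, w] = 0}"

definition theta0 :: "('m mat, 'm::{finite,linorder}) j1 form" where
  "theta0 = wedge_list (map theta (sorted_list_of_set UNIV))"

text \<open>A lift of the frame vector \<open>X\<^sub>k\<close>; contractions of the horizontal form \<open>theta0\<close> do not
  depend on the lift.\<close>

definition frame_vector :: "'m \<Rightarrow> ('m mat, 'm::finite) j1 \<Rightarrow> ('m mat, 'm) j1" where
  "frame_vector k p = (column k (frame_of p), 0, 0)"

definition theta2 :: "'m \<Rightarrow> 'm \<Rightarrow> ('m mat, 'm::{finite,linorder}) j1 form" where
  "theta2 i k = contract (frame_vector i) (contract (frame_vector k) theta0)"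

definition L_PG :: "('m mat, 'm::{finite,linorder}) j1 form" where
  "L_PG p vs = (\<Sum>i\<in>UNIV. \<Sum>q\<in>UNIV. \<Sum>k\<in>UNIV.
     matrix_inv eta $ i $ q * wedge (CARD('m) - 2) 2 (theta2 i k) (Omega k q) p vs)"


section \<open>The first order Einstein--Hilbert form\<close>

text \<open>Components of metrics over \<open>c\<close> expressed over \<open>c'\<close>, and the induced map of 1-jets.\<close>

definition push_metric ::
  "('a, 'm) chart \<Rightarrow> ('a, 'm) chart \<Rightarrow> (real^'m \<Rightarrow> 'm mat) \<Rightarrow> real^'m \<Rightarrow> 'm::finite mat" where
  "push_metric c c' s y =
     (let x = coord_change c' c y; J = jacobian (coord_change c c') (at x)
      in J ** s x ** transpose J)"

definition jet1_change ::
  "('a, 'm) chart \<Rightarrow> ('a, 'm) chart \<Rightarrow> ('m mat, 'm) j1 \<Rightarrow> ('m::finite mat, 'm) j1" where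
  "jet1_change c c' j = jet1 (push_metric c c' (jet1_rep j)) (coord_change c c' (fst j))"

text \<open>The 1-jet of \<open>s\<close> is sent to the 1-jet of the projection of \<open>s\<close> to metrics.\<close>

definition jet1_frame_metric ::
  "('m mat, 'm) j1 \<Rightarrow> ('m::{finite,linorder} mat, 'm) j1" where
  "jet1_frame_metric j = jet1 (frame_metric \<circ> jet1_rep j) (fst j)"

text \<open>Under the action of \<open>h\<close> in \<open>K\<close> on frames, \<open>L_PG\<close> is multiplied by \<open>det h\<close>, which can be
  \<open>-1\<close>; accordingly the scalar curvature times the volume element is an \<open>m\<close>-form only after an
  orientation has been chosen. Without an orientation of \<open>M\<close>, the top degree Lagrangians are forms
  with values in the orientation bundle (odd forms): one form for each chart, oriented by its
  coordinates, with the sign of the Jacobian in the transition rule, and with the sign of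
  \<open>det e\<close> (the orientation of the frame relative to the chart) in the pullback to \<open>T0\<close>. For an
  oriented atlas and positive frames all these signs are 1 and odd forms are forms.\<close>

definition odd_form_on_J1_metrics ::
  "('a, 'm) chart set \<Rightarrow> (('a, 'm) chart \<Rightarrow> ('m::{finite,linorder} mat, 'm) j1 form) \<Rightarrow> bool" where
  "odd_form_on_J1_metrics A L \<longleftrightarrow>
     (\<forall>c\<in>A. differential_form CARD('m) (J1_metrics c) (L c)) \<and>
     (\<forall>c\<in>A. \<forall>c'\<in>A. \<forall>p\<in>J1_metrics c. fst p \<in> snd c ` (fst c \<inter> fst c') \<longrightarrow>
        (\<forall>vs. length vs = CARD('m) \<and> set vs \<subseteq> tangent_vectors (J1_metrics c) p \<longrightarrow>
           L c p vs = sgn (det (jacobian (coord_change c c') (at (fst p))))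
                      * pullback (jet1_change c c') (L c') p vs))"

definition two_horizontal ::
  "('a, 'm) chart set \<Rightarrow> (('a, 'm) chart \<Rightarrow> ('m::{finite,linorder} mat, 'm) j1 form) \<Rightarrow> bool" where
  "two_horizontal A L \<longleftrightarrow>
     (\<forall>c\<in>A. \<forall>p\<in>J1_metrics c. \<forall>v w us.
        length (v # w # us) = CARD('m) \<and> set (v # w # us) \<subseteq> tangent_vectors (J1_metrics c) p \<and>
        fst v = 0 \<and> fst w = 0 \<longrightarrow> L c p (v # w # us) = 0)"

definition is_L_EH1 ::
  "('a, 'm) chart set \<Rightarrow> (('a, 'm) chart \<Rightarrow> ('m::{finite,linorder} mat, 'm) j1 form) \<Rightarrow> bool" where
  "is_L_EH1 A L \<longleftrightarrow>
     odd_form_on_J1_metrics A L \<and> two_horizontal A L \<and>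
     (\<forall>c\<in>A. \<forall>p\<in>T0 c. \<forall>vs. length vs = CARD('m) \<and> set vs \<subseteq> tangent_vectors (T0 c) p \<longrightarrow>
        pullback jet1_frame_metric (L c) p vs = sgn (det (frame_of p)) * L_PG p vs)"


section \<open>The Einstein--Hilbert Lagrangian\<close>

text \<open>Levi-Civita connection and curvature of a metric with contravariant components \<open>g\<close>.\<close>

definition lower :: "(real^'m \<Rightarrow> 'm mat) \<Rightarrow> 'm \<Rightarrow> 'm \<Rightarrow> real^'m \<Rightarrow> real" where
  "lower g \<mu> \<nu> x = matrix_inv (g x) $ \<mu> $ \<nu>"

definition christoffel :: "(real^'m \<Rightarrow> 'm::finite mat) \<Rightarrow> 'm \<Rightarrow> 'm \<Rightarrow> 'm \<Rightarrow> real^'m \<Rightarrow> real" where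
  "christoffel g \<rho> \<mu> \<nu> x =
     (1/2) * (\<Sum>\<sigma>\<in>UNIV. g x $ \<rho> $ \<sigma> *
        (pd \<mu> (lower g \<sigma> \<nu>) x + pd \<nu> (lower g \<sigma> \<mu>) x - pd \<sigma> (lower g \<mu> \<nu>) x))"

definition riemann ::
  "(real^'m \<Rightarrow> 'm::finite mat) \<Rightarrow> 'm \<Rightarrow> 'm \<Rightarrow> 'm \<Rightarrow> 'm \<Rightarrow> real^'m \<Rightarrow> real" where
  "riemann g \<rho> \<sigma> \<mu> \<nu> x =
     pd \<mu> (christoffel g \<rho> \<nu> \<sigma>) x - pd \<nu> (christoffel g \<rho> \<mu> \<sigma>) x +
     (\<Sum>\<kappa>\<in>UNIV. christoffel g \<rho> \<mu> \<kappa> x * christoffel g \<kappa> \<nu> \<sigma> x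
            - christoffel g \<rho> \<nu> \<kappa> x * christoffel g \<kappa> \<mu> \<sigma> x)"

definition scalar_curvature :: "(real^'m \<Rightarrow> 'm::finite mat) \<Rightarrow> real^'m \<Rightarrow> real" where
  "scalar_curvature g x =
     (\<Sum>\<sigma>\<in>UNIV. \<Sum>\<nu>\<in>UNIV. g x $ \<sigma> $ \<nu> * (\<Sum>\<rho>\<in>UNIV. riemann g \<rho> \<sigma> \<rho> \<nu> x))"

definition volume_form :: "((real^'m::{finite,linorder}) \<times> 'b) form" where
  "volume_form = wedge_list
     (map (\<lambda>\<mu> p vs. fst (vs ! 0) $ \<mu>) (sorted_list_of_set UNIV))"

text \<open>The horizontal form \<open>R \<surd>\<bar>det (g\<^sub>\<mu>\<^sub>\<nu>)\<bar> dx\<^sup>1 \<and> \<dots> \<and> dx\<^sup>m\<close> on 2-jets of metrics, by means of a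
  metric field with the given 2-jet. The coordinate expression is the same in every chart.\<close>

definition L_EH :: "('m::{finite,linorder} mat, 'm) j2 form" where
  "L_EH j vs =
     scalar_curvature (jet2_rep j) (fst j) * sqrt \<bar>det (matrix_inv (fst (snd j)))\<bar> * volume_form j vs"


section \<open>Actions and extremals\<close>

text \<open>A section of the bundle of metrics, given by its components in each chart of the atlas.\<close>

type_synonym ('a, 'm) metric_field = "('a, 'm) chart \<Rightarrow> real^'m \<Rightarrow> 'm mat"

definition metric_section ::
  "('a, 'm) chart set \<Rightarrow> ('a, 'm::{finite,linorder}) metric_field \<Rightarrow> bool" where
  "metric_section A g \<longleftrightarrow>
     (\<forall>c\<in>A. smooth_on (chart_image c) (g c) \<and> g c ` chart_image c \<subseteq> metrics) \<and>
     (\<forall>c\<in>A. \<forall>c'\<in>A. \<forall>y \<in> snd c' ` (fst c \<inter> fst c'). g c' y = push_metric c c' (g c) y)"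

text \<open>Integral over a compact \<open>C\<close> of an odd \<open>m\<close>-form on \<open>M\<close>: decompose \<open>C\<close> into finitely many
  Borel pieces, each inside a chart. By the change of variables formula the choice of the
  decomposition \<open>\<kappa>\<close> is immaterial.\<close>

definition chart_selection :: "('a, 'm::finite) chart set \<Rightarrow> 'a set \<Rightarrow> ('a \<Rightarrow> ('a, 'm) chart) \<Rightarrow> bool" where
  "chart_selection A C \<kappa> \<longleftrightarrow>
     finite (\<kappa> ` C) \<and> (\<forall>p\<in>C. \<kappa> p \<in> A \<and> p \<in> fst (\<kappa> p)) \<and>
     (\<forall>c \<in> \<kappa> ` C. snd c ` {p\<in>C. \<kappa> p = c} \<in> sets borel)"

definition integral_odd_form ::
  "('a, 'm::{finite,linorder}) chart set \<Rightarrow> 'a set \<Rightarrow> (('a, 'm) chart \<Rightarrow> 'm coords form) \<Rightarrow> real" where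
  "integral_odd_form A C \<alpha> =
     (let \<kappa> = (SOME \<kappa>. chart_selection A C \<kappa>) in
      \<Sum>c \<in> \<kappa> ` C. LINT x : snd c ` {p\<in>C. \<kappa> p = c} | lborel.
        \<alpha> c x (map (\<lambda>\<mu>. axis \<mu> 1) (sorted_list_of_set UNIV)))"

text \<open>\<open>\<integral>\<^sub>C (j g)\<^sup>* L\<close>, where \<open>jet\<close> is \<open>jet1\<close> or \<open>jet2\<close>.\<close>

definition lagrangian_action ::
  "('a, 'm) chart set \<Rightarrow> (('m coords \<Rightarrow> 'm mat) \<Rightarrow> 'm coords \<Rightarrow> 'j::euclidean_space) \<Rightarrow>
   (('a, 'm) chart \<Rightarrow> 'j form) \<Rightarrow> 'a set \<Rightarrow> ('a, 'm::{finite,linorder}) metric_field \<Rightarrow> real" where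
  "lagrangian_action A jet L C g = integral_odd_form A C (\<lambda>c. pullback (jet (g c)) (L c))"

definition smooth_variation ::
  "('a, 'm) chart set \<Rightarrow> 'a set \<Rightarrow> ('a, 'm) metric_field \<Rightarrow> real \<Rightarrow>
   (real \<Rightarrow> ('a, 'm::{finite,linorder}) metric_field) \<Rightarrow> bool" where
  "smooth_variation A C g \<epsilon> G \<longleftrightarrow>
     0 < \<epsilon> \<and> G 0 = g \<and> (\<forall>t\<in>{-\<epsilon><..<\<epsilon>}. metric_section A (G t)) \<and>
     (\<forall>c\<in>A. smooth_on ({-\<epsilon><..<\<epsilon>} \<times> chart_image c) (\<lambda>(t, x). G t c x)) \<and>
     (\<forall>t\<in>{-\<epsilon><..<\<epsilon>}. \<forall>c\<in>A. \<forall>p \<in> fst c - C. G t c (snd c p) = g c (snd c p))"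

definition extremals ::
  "'a topology \<Rightarrow> ('a, 'm) chart set \<Rightarrow> (('m coords \<Rightarrow> 'm mat) \<Rightarrow> 'm coords \<Rightarrow> 'j::euclidean_space) \<Rightarrow>
   (('a, 'm) chart \<Rightarrow> 'j form) \<Rightarrow> ('a, 'm::{finite,linorder}) metric_field set" where
  "extremals X A jet L =
     {g. metric_section A g \<and>
         (\<forall>C \<epsilon> G. compactin X C \<and> smooth_variation A C g \<epsilon> G \<longrightarrow>
            ((\<lambda>t. lagrangian_action A jet L C (G t)) has_real_derivative 0) (at 0))}"

end

theory Submission
  imports Defs
begin

text \<open>On every chart, both Lagrangians pull back along the jets of a metric \<open>g\<close> to the density
  \<open>R \<surd>\<bar>det (g\<^sub>\<mu>\<^sub>\<nu>)\<bar>\<close>, so the two actions agree on all metrics. For \<open>L_EH\<close> this only says that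
  the scalar curvature depends on the 2-jet of the metric. For \<open>L_EH1\<close>, the section \<open>j\<^sup>1 g\<close> is
  lifted near a point to \<open>T0\<close>: if \<open>e\<close> is a local \<open>g\<close>-orthonormal frame and \<open>\<Gamma>\<close> the Levi-Civita
  connection, then \<open>x \<mapsto> (x, e, - \<Gamma> e)\<close> takes values in \<open>T0\<close> because \<open>\<Gamma>\<close> is symmetric, and
  projects to \<open>j\<^sup>1 g\<close> because \<open>\<Gamma>\<close> is metric. The lift is not holonomic: along it \<open>\<omega>\<close> is the
  connection form \<open>e\<inverse> (de + \<Gamma> e)\<close>, hence \<open>\<Omega>\<close> is the Riemann tensor in the frame \<open>e\<close>, and
  \<open>\<theta>\<^sub>i\<^sub>k \<and> \<Omega>\<^sup>k\<^sub>p = \<Omega>\<^sup>k\<^sub>p(X\<^sub>k, X\<^sub>i) \<theta>\<^sub>0\<close> turns \<open>L_PG\<close> into \<open>R \<theta>\<^sub>0 = R (det e)\<inverse> dx\<close>.\<close>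

section \<open>Matrices\<close>

text \<open>A holonomic lift of \<open>j^1 g\<close> into \<open>T0\<close> would be a parallel
  frame, which exists only for flat metrics; moreover the Cartan form, and with it \<omega> and
  \<Omega>, pulls back to zero along every holonomic section. The curvature therefore has to come
  from a non-holonomic lift. Such a lift is admissible because the identity defining
  \<open>L_EH1\<close> is imposed on all vectors tangent to \<open>T0\<close>: if the lift projects
  to \<open>jet1 g\<close> near a point, the chain rule expresses the pullback of
  \<open>L_EH1\<close> along \<open>jet1 g\<close> by the pullback of \<open>L_PG\<close> along the
  lift. Only the first derivative of the lift at the point enters, so a frame differentiable at that
  point suffices; its own derivative cancels in \<Omega>. The frame is fixed only up to
  \<open>K\<close>, whose elements have determinant 1 or -1, and the factor
  \<open>sgn (det e)\<close> turns \<open>inverse (det e)\<close> into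
  \<open>inverse \<bar>det e\<bar>\<close>, which depends on the metric alone.\<close>

lemma
  fixes A :: "real^'n^'n"
  assumes "invertible A"
  shows matrix_inv_right: "A ** matrix_inv A = mat 1"
    and matrix_inv_left: "matrix_inv A ** A = mat 1"
proof -
  have "A ** matrix_inv A = mat 1 \<and> matrix_inv A ** A = mat 1"
    using assms unfolding invertible_def matrix_inv_def by (rule someI_ex)
  then show "A ** matrix_inv A = mat 1" "matrix_inv A ** A = mat 1" by auto
qed

lemma matrix_inv_unique:
  fixes A :: "real^'n^'n"
  assumes "A ** B = mat 1"
  shows "matrix_inv A = B"
proof -
  have "invertible A" using assms invertible_right_inverse by blast
  then have "matrix_inv A = matrix_inv A ** (A ** B)" by (simp add: assms)
  also have "\<dots> = B" by (simp add: matrix_mul_assoc matrix_inv_left \<open>invertible A\<close>)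
  finally show ?thesis .
qed

lemma transpose_matrix_inv:
  fixes A :: "real^'n^'n"
  assumes "invertible A"
  shows "transpose (matrix_inv A) = matrix_inv (transpose A)"
  by (rule matrix_inv_unique[symmetric])
    (simp add: matrix_transpose_mul[symmetric] matrix_inv_left assms transpose_mat)

lemma det_matrix_inv:
  fixes A :: "real^'n^'n"
  assumes "invertible A"
  shows "det (matrix_inv A) = inverse (det A)"
proof -
  have "det A * det (matrix_inv A) = 1"
    by (simp add: det_mul[symmetric] matrix_inv_right assms)
  then show ?thesis by (metis inverse_unique)
qed

section \<open>The Minkowski matrix and the metrics of frames\<close>

lemma eta_square: "(eta :: 'm::{finite,linorder} mat) ** eta = mat 1"
  by (simp add: eta_def matrix_matrix_mult_def mat_def vec_eq_iff if_distrib[of "\<lambda>x. _ * x"]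
      if_distrib[of "\<lambda>x. x * _"] cong: if_cong)

lemma matrix_inv_eta: "matrix_inv (eta :: 'm::{finite,linorder} mat) = eta"
  by (rule matrix_inv_unique) (rule eta_square)

lemma transpose_eta: "transpose (eta :: 'm::{finite,linorder} mat) = eta"
  by (auto simp: eta_def transpose_def vec_eq_iff)

lemma invertible_eta: "invertible (eta :: 'm::{finite,linorder} mat)"
  using eta_square invertible_right_inverse by blast

lemma abs_det_eta: "\<bar>det (eta :: 'm::{finite,linorder} mat)\<bar> = 1"
proof -
  have "det (eta :: 'm mat) * det (eta :: 'm mat) = 1"
    by (simp add: det_mul[symmetric] eta_square)
  then show ?thesis by (auto simp: square_eq_1_iff)
qed

lemma frame_metric_eq: "frame_metric e = e ** eta ** transpose e"
  by (simp add: frame_metric_def matrix_inv_eta)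

lemma transpose_frame_metric: "transpose (frame_metric e) = frame_metric e"
  by (simp add: frame_metric_eq matrix_transpose_mul transpose_eta matrix_mul_assoc)

lemma invertible_frame_metric:
  assumes "invertible e" shows "invertible (frame_metric e)"
  by (simp add: frame_metric_eq assms invertible_eta invertible_mult transpose_invertible)

lemma abs_det_frame_metric: "\<bar>det (frame_metric e)\<bar> = (det e)\<^sup>2"
  by (simp add: frame_metric_eq det_mul abs_mult abs_det_eta power2_eq_square)

section \<open>Differential calculus of matrix products, transposes, determinants and
  inverses\<close>

lemma bounded_bilinear_matrix_mult:
  "bounded_bilinear ((**) :: real^'n^'m \<Rightarrow> real^'p^'n \<Rightarrow> real^'p^'m)"
  unfolding bilinear_conv_bounded_bilinear[symmetric] bilinear_def
  by (auto intro!: linearI simp: matrix_add_ldistrib matrix_scalar_ac scalar_matrix_assoc)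
    (simp add: matrix_matrix_mult_def vec_eq_iff sum.distrib algebra_simps)

lemma bounded_bilinear_matrix_vector_mult:
  "bounded_bilinear ((*v) :: real^'n^'m \<Rightarrow> real^'n \<Rightarrow> real^'m)"
  unfolding bilinear_conv_bounded_bilinear[symmetric] bilinear_def
  by (auto intro!: linearI simp: matrix_vector_mult_def vec_eq_iff sum.distrib sum_distrib_left algebra_simps)

lemmas matrix_mult_uminus = bounded_bilinear.minus_left[OF bounded_bilinear_matrix_mult]
  bounded_bilinear.minus_right[OF bounded_bilinear_matrix_mult]

lemmas matrix_mult_scaleR = bounded_bilinear.scaleR_left[OF bounded_bilinear_matrix_mult]
  bounded_bilinear.scaleR_right[OF bounded_bilinear_matrix_mult]

lemmas matrix_mult_add = bounded_bilinear.add_left[OF bounded_bilinear_matrix_mult]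
  bounded_bilinear.add_right[OF bounded_bilinear_matrix_mult]

lemmas matrix_mult_diff = bounded_bilinear.diff_left[OF bounded_bilinear_matrix_mult]
  bounded_bilinear.diff_right[OF bounded_bilinear_matrix_mult]

lemmas has_derivative_matrix_mult =
  bounded_bilinear.FDERIV[OF bounded_bilinear_matrix_mult]

lemmas has_derivative_matrix_vector_mult =
  bounded_bilinear.FDERIV[OF bounded_bilinear_matrix_vector_mult]

lemma bounded_linear_transpose: "bounded_linear (transpose :: real^'n^'m \<Rightarrow> real^'m^'n)"
  unfolding linear_conv_bounded_linear[symmetric]
  by (rule linearI) (auto simp: transpose_def vec_eq_iff)

lemmas has_derivative_transpose =
  bounded_linear.has_derivative[OF bounded_linear_transpose]

lemmas has_derivative_vec_nth =
  bounded_linear.has_derivative[OF bounded_linear_vec_nth]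

lemma has_derivative_vec_lambda:
  fixes f :: "'a::real_normed_vector \<Rightarrow> 'i::finite \<Rightarrow> 'b::euclidean_space"
  assumes "\<And>i. ((\<lambda>x. f x i) has_derivative (\<lambda>h. f' h i)) (at x within S)"
  shows "((\<lambda>x. \<chi> i. f x i) has_derivative (\<lambda>h. \<chi> i. f' h i)) (at x within S)"
  unfolding has_derivative_componentwise_within[where f="\<lambda>x. \<chi> i. f x i"]
  using assms
  by (auto simp: Basis_vec_def inner_axis intro!: has_derivative_inner_left)

lemma differentiable_vec_lambda:
  fixes f :: "'a::real_normed_vector \<Rightarrow> 'i::finite \<Rightarrow> 'b::euclidean_space"
  assumes "\<And>i. (\<lambda>x. f x i) differentiable (at x within S)"
  shows "(\<lambda>x. \<chi> i. f x i) differentiable (at x within S)"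
proof -
  from assms obtain f' where "\<And>i. ((\<lambda>x. f x i) has_derivative f' i) (at x within S)"
    unfolding differentiable_def by metis
  then have "((\<lambda>x. \<chi> i. f x i) has_derivative (\<lambda>h. \<chi> i. f' i h)) (at x within S)"
    by (rule has_derivative_vec_lambda)
  then show ?thesis by (rule differentiableI)
qed

lemma differentiable_vec_nth:
  fixes f :: "'a::real_normed_vector \<Rightarrow> ('b::real_normed_vector)^'i"
  assumes "f differentiable (at x within S)"
  shows "(\<lambda>x. f x $ i) differentiable (at x within S)"
  using assms unfolding differentiable_def by (blast intro: has_derivative_vec_nth)

lemma differentiable_matrix_mult:
  fixes f :: "'a::real_normed_vector \<Rightarrow> real^'n^'m" and g :: "'a \<Rightarrow> real^'p^'n"
  assumes "f differentiable (at x within S)" "g differentiable (at x within S)"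
  shows "(\<lambda>x. f x ** g x) differentiable (at x within S)"
  using assms unfolding differentiable_def by (blast intro: has_derivative_matrix_mult)

lemma differentiable_prod:
  fixes f :: "'i \<Rightarrow> 'a::real_normed_vector \<Rightarrow> real"
  assumes "\<And>i. i \<in> I \<Longrightarrow> f i differentiable (at x within S)"
  shows "(\<lambda>x. \<Prod>i\<in>I. f i x) differentiable (at x within S)"
proof -
  from assms obtain f' where "\<And>i. i \<in> I \<Longrightarrow> (f i has_derivative f' i) (at x within S)"
    unfolding differentiable_def by metis
  from has_derivative_prod[OF this] show ?thesis by (rule differentiableI)
qed

lemma differentiable_det:
  fixes f :: "'a::real_normed_vector \<Rightarrow> real^'n^'n"
  assumes "f differentiable (at x within S)"
  shows "(\<lambda>x. det (f x)) differentiable (at x within S)"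
  unfolding det_def
  by (intro differentiable_sum ballI differentiable_mult differentiable_const differentiable_prod
      differentiable_vec_nth assms) (auto simp: finite_permutations)

lemma open_invertible: "open {A :: real^'n^'n. invertible A}"
proof -
  have "continuous_on UNIV (det :: real^'n^'n \<Rightarrow> real)"
    unfolding det_def by (intro continuous_intros)
  then have "open (det -` (- {0}) :: (real^'n^'n) set)"
    by (intro open_vimage) auto
  moreover have "det -` (- {0}) = {A :: real^'n^'n. invertible A}"
    by (auto simp: invertible_det_nz)
  ultimately show ?thesis by simp
qed

lemma eventually_invertible:
  fixes A :: "real^'n^'n"
  assumes "invertible A"
  shows "\<forall>\<^sub>F B in nhds A. invertible B"
  using eventually_nhds_in_open[OF open_invertible, of A] assms by simp

text \<open>By Cramer's rule the entries of the inverse are quotients of polynomials. This yields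
  differentiability of \<open>matrix_inv\<close> before its derivative is known.\<close>

lemma matrix_inv_cramer:
  fixes A :: "real^'n^'n"
  assumes "invertible A"
  shows "matrix_inv A = (\<chi> i j. det (\<chi> a b. if b = i then axis j 1 $ a else A $ a $ b) / det A)"
proof -
  have "matrix_inv A $ i $ j = det (\<chi> a b. if b = i then axis j 1 $ a else A $ a $ b) / det A" for i j
  proof -
    have "A *v (matrix_inv A *v axis j 1) = axis j 1"
      by (simp add: matrix_vector_mul_assoc matrix_inv_right assms)
    moreover have "det A \<noteq> 0" using assms invertible_det_nz by blast
    ultimately have "matrix_inv A *v axis j 1 =
        (\<chi> k. det (\<chi> a b. if b = k then axis j 1 $ a else A $ a $ b) / det A)"
      using cramer[of A "matrix_inv A *v axis j 1" "axis j 1"] by simp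
    moreover have "(matrix_inv A *v axis j 1) $ i = matrix_inv A $ i $ j"
      by (simp add: matrix_vector_mul_component inner_axis)
    ultimately show ?thesis by simp
  qed
  then show ?thesis by (simp add: vec_eq_iff)
qed

lemma differentiable_matrix_inv:
  fixes A :: "real^'n^'n"
  assumes "invertible A"
  shows "matrix_inv differentiable (at A)"
proof -
  have [intro]: "(\<lambda>B::real^'n^'n. if b = i then c else B $ a $ b) differentiable at A"
    for a b i :: 'n and c :: real
    by (cases "b = i") (auto intro!: differentiable_vec_nth)
  have "(\<lambda>A :: real^'n^'n. \<chi> i j. det (\<chi> a b. if b = i then axis j 1 $ a else A $ a $ b) / det A)
      differentiable (at A)"
    using assms unfolding invertible_det_nz
    by (intro differentiable_vec_lambda differentiable_divide differentiable_det) auto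
  then obtain D where "((\<lambda>A :: real^'n^'n. \<chi> i j. det (\<chi> a b. if b = i then axis j 1 $ a else A $ a $ b) / det A)
      has_derivative D) (at A)"
    unfolding differentiable_def by blast
  moreover have "\<forall>\<^sub>F B in at A. (\<chi> i j. det (\<chi> a b. if b = i then axis j 1 $ a else B $ a $ b) / det B)
      = matrix_inv B"
    using eventually_invertible[OF assms]
    unfolding eventually_at_filter by (rule eventually_mono) (simp add: matrix_inv_cramer)
  ultimately have "(matrix_inv has_derivative D) (at A)"
    by (rule has_derivative_transform_eventually) (auto simp: matrix_inv_cramer assms)
  then show ?thesis by (rule differentiableI)
qed

lemma has_derivative_matrix_inv:
  fixes A :: "real^'n^'n"
  assumes "invertible A"
  shows "(matrix_inv has_derivative (\<lambda>B. - (matrix_inv A ** B ** matrix_inv A))) (at A)"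
proof -
  obtain D where D: "(matrix_inv has_derivative D) (at A)"
    using differentiable_matrix_inv[OF assms] unfolding differentiable_def by blast
  \<comment> \<open>The formula comes from differentiating \<open>B ** matrix_inv B\<close> in two
    ways: by the product rule, and as a function equal to \<open>mat 1\<close> on the open set of
    invertible matrices.\<close>
  have "((\<lambda>B. B ** matrix_inv B) has_derivative (\<lambda>B. A ** D B + B ** matrix_inv A)) (at A)"
    by (rule has_derivative_matrix_mult[OF has_derivative_ident D])
  moreover have "((\<lambda>B::real^'n^'n. B ** matrix_inv B) has_derivative (\<lambda>_. 0)) (at A)"
  proof (rule has_derivative_transform_eventually)
    show "((\<lambda>_. mat 1) has_derivative (\<lambda>_. 0)) (at A)" by simp
    show "\<forall>\<^sub>F B in at A. mat 1 = B ** matrix_inv B"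
      using eventually_invertible[OF assms] unfolding eventually_at_filter
      by (rule eventually_mono) (simp add: matrix_inv_right)
  qed (auto simp: matrix_inv_right assms)
  ultimately have "(\<lambda>B. A ** D B + B ** matrix_inv A) = (\<lambda>_. 0)"
    by (rule has_derivative_unique)
  then have *: "A ** D B = - (B ** matrix_inv A)" for B
    using fun_cong[of "\<lambda>B. A ** D B + B ** matrix_inv A" "\<lambda>_. 0" B] by (simp add: eq_neg_iff_add_eq_0)
  have "D B = matrix_inv A ** (A ** D B)" for B
    by (simp add: matrix_mul_assoc matrix_inv_left assms)
  then have "D B = - (matrix_inv A ** B ** matrix_inv A)" for B
    unfolding * by (simp add: matrix_mult_uminus matrix_mul_assoc)
  then have "D = (\<lambda>B. - (matrix_inv A ** B ** matrix_inv A))" by blast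
  with D show ?thesis by simp
qed

lemma has_derivative_matrix_inv_compose:
  fixes f :: "'a::real_normed_vector \<Rightarrow> real^'n^'n"
  assumes "(f has_derivative f') (at x within S)" "invertible (f x)"
  shows "((\<lambda>x. matrix_inv (f x)) has_derivative
     (\<lambda>h. - (matrix_inv (f x) ** f' h ** matrix_inv (f x)))) (at x within S)"
  using has_derivative_compose[OF assms(1) has_derivative_matrix_inv[OF assms(2)]] .

section \<open>The Levi-Civita connection as a function of the 1-jet of the metric\<close>

lemma has_derivative_pd: "(s has_derivative D) (at x) \<Longrightarrow> pd \<sigma> s x = D (axis \<sigma> 1)"
  by (simp add: pd_def flip: frechet_derivative_at)

lemma pd_cong:
  assumes "\<forall>\<^sub>F y in nhds x. f y = g y"
  shows "pd \<sigma> f x = pd \<sigma> g x"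
proof -
  have "(f has_derivative D) (at x) \<longleftrightarrow> (g has_derivative D) (at x)" for D
  proof -
    have "\<forall>\<^sub>F y in at x. f y = g y" "\<forall>\<^sub>F y in at x. g y = f y" "f x = g x" "g x = f x"
      using assms eventually_nhds_x_imp_x[OF assms]
      by (auto simp: eventually_at_filter elim: eventually_mono)
    then show ?thesis by (blast intro: has_derivative_transform_eventually)
  qed
  then show ?thesis by (simp add: pd_def frechet_derivative_def)
qed

text \<open>Metrics are stored contravariantly, so the covariant components form the inverse matrix;
  this is its velocity when \<open>G\<close> moves with velocity \<open>B\<close>.\<close>

definition lower_deriv :: "'m mat \<Rightarrow> 'm mat \<Rightarrow> 'm::finite mat" where
  "lower_deriv G B = - (matrix_inv G ** B ** matrix_inv G)"

text \<open>The Christoffel symbols with one lower index \<mu> fixed, as a matrix in the other two.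
  Taking the 1-jet as an explicit argument makes the chain rule applicable to the
  connection.\<close>

definition levi_civita :: "'m mat \<Rightarrow> 'm mat^'m \<Rightarrow> 'm \<Rightarrow> 'm::finite mat" where
  "levi_civita G B \<mu> = (\<chi> \<rho> \<nu>. (1/2) * (\<Sum>\<sigma>\<in>UNIV. G $ \<rho> $ \<sigma> *
     (lower_deriv G (B $ \<mu>) $ \<sigma> $ \<nu> + lower_deriv G (B $ \<nu>) $ \<sigma> $ \<mu> - lower_deriv G (B $ \<sigma>) $ \<mu> $ \<nu>)))"

definition connection :: "(real^'m \<Rightarrow> 'm mat) \<Rightarrow> 'm \<Rightarrow> real^'m \<Rightarrow> 'm::finite mat" where
  "connection g \<mu> x = levi_civita (g x) (\<chi> \<sigma>. pd \<sigma> g x) \<mu>"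

lemma pd_lower:
  assumes "g differentiable at x" "invertible (g x)"
  shows "pd \<mu> (lower g \<sigma> \<nu>) x = lower_deriv (g x) (pd \<mu> g x) $ \<sigma> $ \<nu>"
proof -
  obtain D where D: "(g has_derivative D) (at x)" using assms(1) by (auto simp: differentiable_def)
  have "((\<lambda>x. matrix_inv (g x) $ \<sigma> $ \<nu>) has_derivative
      (\<lambda>h. (- (matrix_inv (g x) ** D h ** matrix_inv (g x))) $ \<sigma> $ \<nu>)) (at x)"
    by (intro has_derivative_vec_nth has_derivative_matrix_inv_compose D assms)
  then have "(lower g \<sigma> \<nu> has_derivative (\<lambda>h. lower_deriv (g x) (D h) $ \<sigma> $ \<nu>)) (at x)"
    unfolding lower_def lower_deriv_def by simp
  from has_derivative_pd[OF this] show ?thesis by (simp add: has_derivative_pd[OF D])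
qed

lemma christoffel_eq:
  assumes "g differentiable at x" "invertible (g x)"
  shows "christoffel g \<rho> \<mu> \<nu> x = connection g \<mu> x $ \<rho> $ \<nu>"
  by (simp add: christoffel_def connection_def levi_civita_def pd_lower[OF assms])

lemma lower_deriv_symmetric:
  assumes "transpose G = G" "invertible G" "transpose B = B"
  shows "transpose (lower_deriv G B) = lower_deriv G B"
proof -
  have "transpose (lower_deriv G B) = - transpose (matrix_inv G ** B ** matrix_inv G)"
    by (simp add: lower_deriv_def transpose_def vec_eq_iff)
  then show ?thesis
    by (simp add: matrix_transpose_mul transpose_matrix_inv assms matrix_mul_assoc lower_deriv_def)
qed

text \<open>Lowering \<rho> turns the connection into half of \<open>S\<close> below. The last two
  summands of \<open>S\<close> are together antisymmetric, so \<open>S + transpose S\<close> retains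
  only the derivative of the covariant metric; raising both indices again gives
  \<open>- (B $ \<mu>)\<close>.\<close>

lemma
  assumes "transpose G = G" "invertible G" "\<And>\<sigma>. transpose (B $ \<sigma>) = B $ \<sigma>"
  shows levi_civita_symmetric: "levi_civita G B \<mu> $ \<rho> $ \<nu> = levi_civita G B \<nu> $ \<rho> $ \<mu>"
    and levi_civita_metric:
      "levi_civita G B \<mu> ** G + G ** transpose (levi_civita G B \<mu>) = - (B $ \<mu>)"
proof -
  define L where "L \<mu> = lower_deriv G (B $ \<mu>)" for \<mu>
  have L_sym: "L \<sigma> $ a $ b = L \<sigma> $ b $ a" for \<sigma> a b
    using arg_cong[OF lower_deriv_symmetric[OF assms(1,2,3), of \<sigma>], of "\<lambda>M. M $ b $ a"]
    by (simp add: L_def transpose_def)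
  show "levi_civita G B \<mu> $ \<rho> $ \<nu> = levi_civita G B \<nu> $ \<rho> $ \<mu>"
    by (simp add: levi_civita_def flip: L_def) (simp add: L_sym[of _ \<mu> \<nu>] add_ac)
  define S :: "real^'a^'a" where "S = (\<chi> \<sigma> \<nu>. L \<mu> $ \<sigma> $ \<nu> + L \<nu> $ \<sigma> $ \<mu> - L \<sigma> $ \<mu> $ \<nu>)"
  have lc: "levi_civita G B \<mu> = (1/2) *\<^sub>R (G ** S)"
    by (simp add: levi_civita_def S_def matrix_matrix_mult_def vec_eq_iff flip: L_def)
  have "S + transpose S = 2 *\<^sub>R L \<mu>"
    by (simp add: S_def transpose_def vec_eq_iff L_sym[of _ \<mu>]) (metis L_sym)
  note G = assms(1)
  have "levi_civita G B \<mu> ** G + G ** transpose (levi_civita G B \<mu>)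
      = (1/2) *\<^sub>R (G ** S ** G) + (1/2) *\<^sub>R (G ** (transpose S ** G))"
    by (simp add: lc matrix_transpose_mul G transpose_scalar matrix_mult_scaleR)
  also have "\<dots> = (1/2) *\<^sub>R (G ** (S + transpose S) ** G)"
    by (simp add: matrix_mult_add scaleR_add_right matrix_mul_assoc)
  also have "\<dots> = G ** L \<mu> ** G"
    unfolding \<open>S + transpose S = _\<close> by (simp add: matrix_mult_scaleR)
  also have "\<dots> = - ((G ** matrix_inv G) ** B $ \<mu> ** (matrix_inv G ** G))"
    by (simp add: L_def lower_deriv_def matrix_mult_uminus matrix_mul_assoc)
  also have "\<dots> = - (B $ \<mu>)"
    by (simp add: matrix_inv_left matrix_inv_right assms)
  finally show "levi_civita G B \<mu> ** G + G ** transpose (levi_civita G B \<mu>) = - (B $ \<mu>)" .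
qed

lemma differentiable_levi_civita:
  assumes "invertible G"
  shows "(\<lambda>(G, B). levi_civita G B \<mu>) differentiable (at (G, B))"
proof -
  have inv: "(\<lambda>p. matrix_inv (fst p)) differentiable at (G, B)"
    using has_derivative_matrix_inv_compose[OF bounded_linear_imp_has_derivative[OF bounded_linear_fst]] assms
    by (auto intro!: differentiableI)
  have fst: "fst differentiable at (G, B)" and snd: "snd differentiable at (G, B)"
    by (simp_all add: bounded_linear_imp_differentiable bounded_linear_fst bounded_linear_snd)
  have fst_nth: "(\<lambda>p. fst p $ a $ b) differentiable at (G, B)" for a b
    by (rule differentiable_vec_nth[OF differentiable_vec_nth[OF fst]])
  have low: "(\<lambda>p. lower_deriv (fst p) (snd p $ \<sigma>)) differentiable at (G, B)" for \<sigma>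
    unfolding lower_deriv_def
    by (rule differentiable_minus[OF differentiable_matrix_mult[OF differentiable_matrix_mult[OF inv
          differentiable_vec_nth[OF snd]] inv]])
  have low_nth: "(\<lambda>p. lower_deriv (fst p) (snd p $ \<sigma>) $ a $ b) differentiable at (G, B)" for \<sigma> a b
    by (rule differentiable_vec_nth[OF differentiable_vec_nth[OF low]])
  show ?thesis
    unfolding levi_civita_def split_beta
    by (rule differentiable_vec_lambda)+
      (intro differentiable_mult differentiable_const differentiable_sum
        differentiable_add differentiable_diff ballI finite fst_nth low_nth)
qed

text \<open>Regularity at a single point that is enough for the curvature there and for commuting
  mixed partial derivatives. Smooth metric components and the quadratic representatives of 2-jets
  both have it.\<close>

definition twice_differentiable :: "(real^'m::finite \<Rightarrow> 'f::real_normed_vector) \<Rightarrow> real^'m \<Rightarrow> bool" where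
  "twice_differentiable g x \<longleftrightarrow>
     (\<forall>\<^sub>F y in nhds x. g differentiable at y) \<and> (\<forall>\<sigma>. pd \<sigma> g differentiable at x)"

lemma twice_differentiableD:
  assumes "twice_differentiable g x"
  shows "g differentiable at x" "isCont g x"
  using assms unfolding twice_differentiable_def
  by (auto dest: eventually_nhds_x_imp_x intro: differentiable_imp_continuous_within)

lemma eventually_invertible_comp:
  fixes g :: "real^'m \<Rightarrow> real^'n^'n"
  assumes "isCont g x" "invertible (g x)"
  shows "\<forall>\<^sub>F y in nhds x. invertible (g y)"
proof -
  have "filterlim g (nhds (g x)) (nhds x)"
    using assms(1) by (simp add: isCont_def tendsto_at_iff_tendsto_nhds)
  with eventually_invertible[OF assms(2)] show ?thesis
    unfolding filterlim_iff by blast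
qed

text \<open>\<open>D\<close> belongs to \<open>levi_civita\<close> at the 1-jet of the metric, so
  two metrics with the same 1-jet share it, and the derivatives of their connections differ only
  through the second derivatives inserted into \<open>D\<close>.\<close>

lemma connection_has_derivative:
  assumes "twice_differentiable g x" "invertible (g x)"
  obtains D where "((\<lambda>(G, B). levi_civita G B \<mu>) has_derivative D) (at (g x, \<chi> \<sigma>. pd \<sigma> g x))"
    "(connection g \<mu> has_derivative
        (\<lambda>h. D (frechet_derivative g (at x) h, \<chi> \<sigma>. frechet_derivative (pd \<sigma> g) (at x) h))) (at x)"
proof -
  obtain D where D: "((\<lambda>(G, B). levi_civita G B \<mu>) has_derivative D) (at (g x, \<chi> \<sigma>. pd \<sigma> g x))"
    using differentiable_levi_civita[OF assms(2)] unfolding differentiable_def by blast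
  have g: "(g has_derivative frechet_derivative g (at x)) (at x)"
    using twice_differentiableD[OF assms(1)] frechet_derivative_works by blast
  have pd: "(pd \<sigma> g has_derivative frechet_derivative (pd \<sigma> g) (at x)) (at x)" for \<sigma>
    using assms(1) unfolding twice_differentiable_def by (simp add: frechet_derivative_works)
  have "((\<lambda>y. (g y, \<chi> \<sigma>. pd \<sigma> g y)) has_derivative
      (\<lambda>h. (frechet_derivative g (at x) h, \<chi> \<sigma>. frechet_derivative (pd \<sigma> g) (at x) h))) (at x)"
    by (rule has_derivative_Pair[OF g has_derivative_vec_lambda]) (rule pd)
  from has_derivative_compose[OF this D] have
    "(connection g \<mu> has_derivative
        (\<lambda>h. D (frechet_derivative g (at x) h, \<chi> \<sigma>. frechet_derivative (pd \<sigma> g) (at x) h))) (at x)"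
    unfolding connection_def[abs_def] by simp
  with D show ?thesis by (rule that)
qed

lemma connection_differentiable:
  assumes "twice_differentiable g x" "invertible (g x)"
  shows "connection g \<mu> differentiable at x"
  by (rule connection_has_derivative[OF assms, of \<mu>]) (rule differentiableI)

lemma pd_connection_cong:
  assumes "twice_differentiable g x" "twice_differentiable h x" "invertible (g x)"
    and "h x = g x" "\<And>\<sigma>. pd \<sigma> h x = pd \<sigma> g x" "\<And>\<nu>. pd \<sigma> (pd \<nu> h) x = pd \<sigma> (pd \<nu> g) x"
  shows "pd \<sigma> (connection h \<mu>) x = pd \<sigma> (connection g \<mu>) x"
proof -
  obtain D where D: "((\<lambda>(G, B). levi_civita G B \<mu>) has_derivative D) (at (g x, \<chi> \<sigma>. pd \<sigma> g x))"
    "(connection g \<mu> has_derivative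
        (\<lambda>k. D (frechet_derivative g (at x) k, \<chi> \<sigma>. frechet_derivative (pd \<sigma> g) (at x) k))) (at x)"
    by (rule connection_has_derivative[OF assms(1,3)])
  obtain D' where D': "((\<lambda>(G, B). levi_civita G B \<mu>) has_derivative D') (at (g x, \<chi> \<sigma>. pd \<sigma> g x))"
    "(connection h \<mu> has_derivative
        (\<lambda>k. D' (frechet_derivative h (at x) k, \<chi> \<sigma>. frechet_derivative (pd \<sigma> h) (at x) k))) (at x)"
    using connection_has_derivative[OF assms(2), unfolded assms(4,5), OF assms(3), of \<mu>] .
  have "D' = D" by (rule has_derivative_unique[OF D'(1) D(1)])
  with has_derivative_pd[OF D(2)] has_derivative_pd[OF D'(2)] assms(5,6) show ?thesis
    by (simp add: pd_def)
qed

text \<open>The curvature \<open>d\<Gamma> + \<Gamma> \<and> \<Gamma>\<close> on the coordinate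
  vectors \<mu>, \<nu>, as an endomorphism. In this form it can be conjugated by a frame.\<close>

definition curvature_matrix :: "(real^'m \<Rightarrow> 'm mat) \<Rightarrow> 'm \<Rightarrow> 'm \<Rightarrow> real^'m \<Rightarrow> 'm::finite mat" where
  "curvature_matrix g \<mu> \<nu> x = pd \<mu> (connection g \<nu>) x - pd \<nu> (connection g \<mu>) x
     + (connection g \<mu> x ** connection g \<nu> x - connection g \<nu> x ** connection g \<mu> x)"

lemma riemann_eq:
  assumes "twice_differentiable g x" "invertible (g x)"
  shows "riemann g \<rho> \<sigma> \<mu> \<nu> x = curvature_matrix g \<mu> \<nu> x $ \<rho> $ \<sigma>"
proof -
  have "\<forall>\<^sub>F y in nhds x. christoffel g \<rho> \<mu> \<sigma> y = connection g \<mu> y $ \<rho> $ \<sigma>" for \<mu> \<rho> \<sigma>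
    using assms(1)[unfolded twice_differentiable_def, THEN conjunct1]
      eventually_invertible_comp[OF twice_differentiableD(2)[OF assms(1)] assms(2)]
    by eventually_elim (rule christoffel_eq)
  note chr = this eventually_nhds_x_imp_x[OF this]
  have "pd \<nu> (\<lambda>y. connection g \<mu> y $ \<rho> $ \<sigma>) x = pd \<nu> (connection g \<mu>) x $ \<rho> $ \<sigma>" for \<mu> \<nu> \<rho> \<sigma>
  proof -
    have D: "(connection g \<mu> has_derivative frechet_derivative (connection g \<mu>) (at x)) (at x)"
      using connection_differentiable[OF assms] by (simp add: frechet_derivative_works)
    from has_derivative_pd[OF has_derivative_vec_nth[OF has_derivative_vec_nth[OF D]]]
    show ?thesis by (simp add: pd_def)
  qed
  then show ?thesis
    by (simp add: riemann_def curvature_matrix_def chr(2) pd_cong[OF chr(1)] matrix_matrix_mult_def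
        sum_subtractf)
qed

lemma scalar_curvature_eq:
  assumes "twice_differentiable g x" "invertible (g x)"
  shows "scalar_curvature g x = (\<Sum>\<sigma>\<in>UNIV. \<Sum>\<nu>\<in>UNIV. g x $ \<sigma> $ \<nu> *
     (\<Sum>\<rho>\<in>UNIV. curvature_matrix g \<rho> \<nu> x $ \<rho> $ \<sigma>))"
  by (simp add: scalar_curvature_def riemann_eq[OF assms])

lemma scalar_curvature_cong:
  assumes "twice_differentiable g x" "twice_differentiable h x" "invertible (g x)"
    and "h x = g x" "\<And>\<sigma>. pd \<sigma> h x = pd \<sigma> g x" "\<And>\<sigma> \<nu>. pd \<sigma> (pd \<nu> h) x = pd \<sigma> (pd \<nu> g) x"
  shows "scalar_curvature h x = scalar_curvature g x"
proof -
  have "curvature_matrix h \<mu> \<nu> x = curvature_matrix g \<mu> \<nu> x" for \<mu> \<nu>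
    by (simp add: curvature_matrix_def pd_connection_cong[OF assms] connection_def assms(4,5))
  then show ?thesis
    using assms by (simp add: scalar_curvature_eq)
qed

section \<open>Symmetry of second derivatives and representatives of 2-jets\<close>

lemma smooth_on_differentiable:
  assumes "smooth_on S f" "x \<in> S"
  shows "f differentiable at x"
  using assms(1)[unfolded smooth_on_def, rule_format, of "Suc 0"] assms(2) by simp

lemma smooth_on_frechet_derivative:
  assumes "smooth_on S f"
  shows "smooth_on S (\<lambda>x. frechet_derivative f (at x) v)"
  unfolding smooth_on_def
proof
  fix n
  show "Ck_on n S (\<lambda>x. frechet_derivative f (at x) v)"
    using assms[unfolded smooth_on_def, rule_format, of "Suc n"] by simp
qed

lemma smooth_on_pd: "smooth_on S f \<Longrightarrow> smooth_on S (pd \<sigma> f)"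
  unfolding pd_def[abs_def] by (rule smooth_on_frechet_derivative)

lemma smooth_on_twice_differentiable:
  assumes "smooth_on S f" "open S" "x \<in> S"
  shows "twice_differentiable f x"
  unfolding twice_differentiable_def
  using assms eventually_nhds_in_open[OF assms(2,3)]
  by (auto intro: smooth_on_differentiable smooth_on_pd elim: eventually_mono)

text \<open>The mean value theorem, applied to \<open>s \<mapsto> f (x + s u + t v) - f (x + s u)\<close>.\<close>

lemma second_difference_tendsto:
  fixes f :: "'a::real_normed_vector \<Rightarrow> real"
  assumes f: "\<forall>\<^sub>F y in nhds x. (f has_derivative F y) (at y)"
    and D: "((\<lambda>y. F y u) has_derivative D) (at x)"
  shows "((\<lambda>t. (f (x + t *\<^sub>R u + t *\<^sub>R v) - f (x + t *\<^sub>R u) - f (x + t *\<^sub>R v) + f x) / t\<^sup>2)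
     \<longlongrightarrow> D v) (at_right 0)"
proof (rule tendstoI)
  fix e :: real assume "e > 0"
  \<comment> \<open>The two remainders below are bounded in terms of
    \<open>t * (norm u + norm v)\<close> and \<open>t * norm u\<close>; \<open>K\<close> dominates
    the sum of the factors, and the summand 1 keeps it positive. With tolerance
    \<open>e / (2 * K)\<close> the quotient is off by at most \<open>e / 2\<close>.\<close>
  define K where "K = 2 * norm u + norm v + 1"
  have "K > 0" unfolding K_def by (smt (verit) norm_ge_zero)
  obtain d1 where d1: "d1 > 0" "\<And>y. dist y x < d1 \<Longrightarrow> (f has_derivative F y) (at y)"
    using f unfolding eventually_nhds_metric by blast
  have "e / (2 * K) > 0" using \<open>e > 0\<close> \<open>K > 0\<close> by simp
  then obtain d2 where d2: "d2 > 0"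
    "\<And>y. norm (y - x) < d2 \<Longrightarrow> norm (F y u - F x u - D (y - x)) \<le> e / (2 * K) * norm (y - x)"
    using D unfolding has_derivative_at_alt by blast
  define d where "d = min d1 d2 / K"
  have "d > 0" using d1 d2 \<open>K > 0\<close> by (simp add: d_def)
  show "\<forall>\<^sub>F t in at_right 0.
     dist ((f (x + t *\<^sub>R u + t *\<^sub>R v) - f (x + t *\<^sub>R u) - f (x + t *\<^sub>R v) + f x) / t\<^sup>2) (D v) < e"
  proof (rule eventually_at_rightI[OF _ \<open>d > 0\<close>])
    fix t assume t: "t \<in> {0<..<d}"
    have small: "norm (s *\<^sub>R u + r *\<^sub>R v) < min d1 d2 \<and> norm (s *\<^sub>R u + r *\<^sub>R v) \<le> t * (norm u + norm v)"
      if "0 \<le> s" "s \<le> t" "0 \<le> r" "r \<le> t" for s r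
    proof -
      have "norm (s *\<^sub>R u + r *\<^sub>R v) \<le> s * norm u + r * norm v"
        using norm_triangle_ineq[of "s *\<^sub>R u" "r *\<^sub>R v"] that by simp
      also have "\<dots> \<le> t * (norm u + norm v)"
        using that by (simp add: distrib_left add_mono mult_right_mono)
      finally have *: "norm (s *\<^sub>R u + r *\<^sub>R v) \<le> t * (norm u + norm v)" .
      also have "\<dots> \<le> t * K" using t by (simp add: K_def)
      also have "\<dots> < d * K" using t \<open>K > 0\<close> by simp
      also have "\<dots> = min d1 d2" using \<open>K > 0\<close> by (simp add: d_def)
      finally show ?thesis using * by simp
    qed
    define h where "h s = f (x + s *\<^sub>R u + t *\<^sub>R v) - f (x + s *\<^sub>R u)" for s
    have h: "(h has_derivative (\<lambda>k. F (x + s *\<^sub>R u + t *\<^sub>R v) (k *\<^sub>R u) - F (x + s *\<^sub>R u) (k *\<^sub>R u))) (at s)"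
      if "0 \<le> s" "s \<le> t" for s
    proof -
      have 1: "(f has_derivative F (x + s *\<^sub>R u + t *\<^sub>R v)) (at (x + s *\<^sub>R u + t *\<^sub>R v))"
        using d1(2)[of "x + s *\<^sub>R u + t *\<^sub>R v"] small[of s t] that t by (auto simp: dist_norm add.assoc)
      have 2: "(f has_derivative F (x + s *\<^sub>R u)) (at (x + s *\<^sub>R u))"
        using d1(2)[of "x + s *\<^sub>R u"] small[of s 0] that t by (auto simp: dist_norm add.assoc)
      have 3: "((\<lambda>s. x + s *\<^sub>R u + t *\<^sub>R v) has_derivative (\<lambda>k. k *\<^sub>R u)) (at s)"
        by (auto intro!: derivative_eq_intros)
      have 4: "((\<lambda>s. x + s *\<^sub>R u) has_derivative (\<lambda>k. k *\<^sub>R u)) (at s)"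
        by (auto intro!: derivative_eq_intros)
      show ?thesis unfolding h_def[abs_def]
        by (rule has_derivative_diff[OF has_derivative_compose[OF 3 1] has_derivative_compose[OF 4 2]])
    qed
    have "\<exists>s\<in>{0<..<t}. h t - h 0 = F (x + s *\<^sub>R u + t *\<^sub>R v) ((t - 0) *\<^sub>R u) - F (x + s *\<^sub>R u) ((t - 0) *\<^sub>R u)"
      by (rule mvt_simple) (use t h has_derivative_at_withinI in force)+
    then obtain s where s: "s \<in> {0<..<t}"
      and mvt: "h t - h 0 = F (x + s *\<^sub>R u + t *\<^sub>R v) (t *\<^sub>R u) - F (x + s *\<^sub>R u) (t *\<^sub>R u)" by auto
    have lin: "linear (F y)" if "dist y x < d1" for y
      using d1(2)[OF that] has_derivative_linear by blast
    have F: "F (x + s *\<^sub>R u + t *\<^sub>R v) (t *\<^sub>R u) = t * F (x + s *\<^sub>R u + t *\<^sub>R v) u"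
        "F (x + s *\<^sub>R u) (t *\<^sub>R u) = t * F (x + s *\<^sub>R u) u"
      using lin[of "x + s *\<^sub>R u + t *\<^sub>R v"] lin[of "x + s *\<^sub>R u"] small[of s t] small[of s 0] s t
      by (auto simp: dist_norm add.assoc linear_cmul)
    \<comment> \<open>The derivative of \<open>\<lambda>y. F y u\<close> is known only at
      \<open>x\<close>, not at the mean value point, so both values of \<open>F\<close> are expanded
      around \<open>x\<close>. The contributions \<open>D (s *\<^sub>R u)\<close> cancel in their
      difference and \<open>t * D v\<close> remains.\<close>
    define R1 where "R1 = F (x + s *\<^sub>R u + t *\<^sub>R v) u - F x u - D (s *\<^sub>R u + t *\<^sub>R v)"
    define R2 where "R2 = F (x + s *\<^sub>R u) u - F x u - D (s *\<^sub>R u)"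
    have R1: "\<bar>R1\<bar> \<le> e / (2 * K) * (t * (norm u + norm v))"
    proof -
      have "\<bar>R1\<bar> \<le> e / (2 * K) * norm (s *\<^sub>R u + t *\<^sub>R v)"
        using d2(2)[of "x + (s *\<^sub>R u + t *\<^sub>R v)"] small[of s t] s t by (simp add: R1_def add.assoc)
      also have "\<dots> \<le> e / (2 * K) * (t * (norm u + norm v))"
        using small[of s t] s t \<open>e / (2 * K) > 0\<close> by (intro mult_left_mono) auto
      finally show ?thesis .
    qed
    have R2: "\<bar>R2\<bar> \<le> e / (2 * K) * (t * norm u)"
    proof -
      have "\<bar>R2\<bar> \<le> e / (2 * K) * norm (s *\<^sub>R u)"
        using d2(2)[of "x + s *\<^sub>R u"] small[of s 0] s t by (simp add: R2_def)
      also have "\<dots> \<le> e / (2 * K) * (t * norm u)"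
        using s t \<open>e / (2 * K) > 0\<close> by (intro mult_left_mono) (auto intro: mult_right_mono)
      finally show ?thesis .
    qed
    have "linear D" using D has_derivative_linear by blast
    then have "D (s *\<^sub>R u + t *\<^sub>R v) = D (s *\<^sub>R u) + t * D v"
      by (simp add: linear_add linear_cmul)
    then have "h t - h 0 = t * (t * D v + (R1 - R2))"
      unfolding mvt F R1_def R2_def by (simp add: algebra_simps)
    moreover have "h t - h 0 = f (x + t *\<^sub>R u + t *\<^sub>R v) - f (x + t *\<^sub>R u) - f (x + t *\<^sub>R v) + f x"
      by (simp add: h_def)
    ultimately have "f (x + t *\<^sub>R u + t *\<^sub>R v) - f (x + t *\<^sub>R u) - f (x + t *\<^sub>R v) + f x
        = t * (t * D v + (R1 - R2))" by simp
    then have "(f (x + t *\<^sub>R u + t *\<^sub>R v) - f (x + t *\<^sub>R u) - f (x + t *\<^sub>R v) + f x) / t\<^sup>2 - D v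
        = (R1 - R2) / t"
      using t by (simp add: power2_eq_square add_divide_distrib distrib_left)
    moreover have "\<bar>(R1 - R2) / t\<bar> < e"
    proof -
      define c where "c = e / (2 * K)"
      have "c > 0" "c * K = e / 2" using \<open>e > 0\<close> \<open>K > 0\<close> by (simp_all add: c_def)
      have "\<bar>R1 - R2\<bar> \<le> c * (t * (norm u + norm v)) + c * (t * norm u)"
        using R1 R2 unfolding c_def by linarith
      also have "\<dots> = t * (c * (2 * norm u + norm v))" by (simp add: algebra_simps)
      also have "\<dots> \<le> t * (c * K)"
        using t \<open>c > 0\<close> by (intro mult_left_mono) (auto simp: K_def)
      also have "\<dots> < e * t" using \<open>e > 0\<close> t by (simp add: \<open>c * K = _\<close>)
      finally show ?thesis using t by (simp add: divide_less_eq)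
    qed
    ultimately show "dist ((f (x + t *\<^sub>R u + t *\<^sub>R v) - f (x + t *\<^sub>R u) - f (x + t *\<^sub>R v) + f x) / t\<^sup>2) (D v) < e"
      by (simp add: dist_real_def)
  qed
qed

text \<open>The second difference quotient is unchanged when \<open>u\<close> and \<open>v\<close>
  are exchanged, and limits are unique. Inner products with basis vectors reduce the claim to
  real-valued functions.\<close>

theorem second_derivative_symmetric:
  fixes f :: "'a::real_normed_vector \<Rightarrow> 'b::euclidean_space"
  assumes f: "\<forall>\<^sub>F y in nhds x. (f has_derivative F y) (at y)"
    and D: "((\<lambda>y. F y u) has_derivative D) (at x)" "((\<lambda>y. F y v) has_derivative E) (at x)"
  shows "D v = E u"
proof (rule euclidean_eqI)
  fix b :: 'b
  have fb: "\<forall>\<^sub>F y in nhds x. ((\<lambda>y. f y \<bullet> b) has_derivative (\<lambda>h. F y h \<bullet> b)) (at y)"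
    using f by eventually_elim (rule has_derivative_inner_left)
  have "((\<lambda>t. (f (x + t *\<^sub>R u + t *\<^sub>R v) \<bullet> b - f (x + t *\<^sub>R u) \<bullet> b - f (x + t *\<^sub>R v) \<bullet> b + f x \<bullet> b) / t\<^sup>2)
     \<longlongrightarrow> D v \<bullet> b) (at_right 0)"
    by (rule second_difference_tendsto[OF fb]) (rule has_derivative_inner_left[OF D(1)])
  moreover have "((\<lambda>t. (f (x + t *\<^sub>R v + t *\<^sub>R u) \<bullet> b - f (x + t *\<^sub>R v) \<bullet> b - f (x + t *\<^sub>R u) \<bullet> b + f x \<bullet> b) / t\<^sup>2)
     \<longlongrightarrow> E u \<bullet> b) (at_right 0)"
    by (rule second_difference_tendsto[OF fb]) (rule has_derivative_inner_left[OF D(2)])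
  ultimately show "D v \<bullet> b = E u \<bullet> b"
    by (intro tendsto_unique[OF trivial_limit_at_right_real]) (simp_all add: algebra_simps)
qed

lemma pd_commute:
  fixes g :: "real^'m \<Rightarrow> 'f::euclidean_space"
  assumes "twice_differentiable g x"
  shows "pd \<sigma> (pd \<nu> g) x = pd \<nu> (pd \<sigma> g) x"
proof -
  have g: "\<forall>\<^sub>F y in nhds x. (g has_derivative frechet_derivative g (at y)) (at y)"
    using assms unfolding twice_differentiable_def frechet_derivative_works by blast
  have pd: "((\<lambda>y. frechet_derivative g (at y) (axis \<mu> 1)) has_derivative
      frechet_derivative (pd \<mu> g) (at x)) (at x)" for \<mu>
  proof -
    have "(pd \<mu> g has_derivative frechet_derivative (pd \<mu> g) (at x)) (at x)"
      using assms unfolding twice_differentiable_def frechet_derivative_works by blast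
    then show ?thesis by (simp add: pd_def[abs_def])
  qed
  show ?thesis
    using second_derivative_symmetric[OF g pd pd, of \<nu> \<sigma>] by (simp add: pd_def[of _ "pd _ g"])
qed

text \<open>The second derivatives of the quadratic polynomial are
  \<open>(w \<sigma> \<nu> + w \<nu> \<sigma>) / 2\<close>; they reproduce those of \<open>g\<close>
  because mixed partial derivatives of \<open>g\<close> commute. This connects \<open>L_EH\<close>,
  evaluated on \<open>jet2_rep\<close>, with the metric itself.\<close>

lemma
  fixes g :: "real^'m::finite \<Rightarrow> 'f::euclidean_space"
  assumes g: "twice_differentiable g x"
  defines "h \<equiv> jet2_rep (jet2 g x)"
  shows jet2_rep_at: "h x = g x"
    and pd_jet2_rep: "pd \<sigma> h x = pd \<sigma> g x"
    and pd_pd_jet2_rep: "pd \<sigma> (pd \<nu> h) x = pd \<sigma> (pd \<nu> g) x"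
    and twice_differentiable_jet2_rep: "twice_differentiable h x"
proof -
  define w where "w \<sigma> \<nu> = pd \<sigma> (pd \<nu> g) x" for \<sigma> \<nu>
  have w_sym: "w \<sigma> \<nu> = w \<nu> \<sigma>" for \<sigma> \<nu>
    unfolding w_def by (rule pd_commute[OF g])
  have h: "h = (\<lambda>y. g x + (\<Sum>\<sigma>\<in>UNIV. (y - x) $ \<sigma> *\<^sub>R pd \<sigma> g x) +
     (1/2) *\<^sub>R (\<Sum>\<sigma>\<in>UNIV. \<Sum>\<nu>\<in>UNIV. ((y - x) $ \<sigma> * (y - x) $ \<nu>) *\<^sub>R w \<sigma> \<nu>))"
    by (simp add: h_def jet2_rep_def jet2_def w_def fun_eq_iff)
  have lin: "((\<lambda>y. (y - x) $ \<sigma>) has_derivative (\<lambda>k. k $ \<sigma>)) (at y)" for y :: "real^'m" and \<sigma>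
    using has_derivative_vec_nth[OF has_derivative_diff[OF has_derivative_ident has_derivative_const]]
    by fastforce
  have "(h has_derivative (\<lambda>k. (\<Sum>\<sigma>\<in>UNIV. k $ \<sigma> *\<^sub>R pd \<sigma> g x) +
     (1/2) *\<^sub>R (\<Sum>\<sigma>\<in>UNIV. \<Sum>\<nu>\<in>UNIV. ((y - x) $ \<sigma> * k $ \<nu> + k $ \<sigma> * (y - x) $ \<nu>) *\<^sub>R w \<sigma> \<nu>))) (at y)" for y
    unfolding h
    by (rule derivative_eq_intros refl lin)+ (simp add: fun_eq_iff)
  note h' = this
  have pd_h: "pd \<tau> h = (\<lambda>y. pd \<tau> g x + (\<Sum>\<sigma>\<in>UNIV. (y - x) $ \<sigma> *\<^sub>R w \<sigma> \<tau>))" for \<tau>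
  proof
    fix y
    have "pd \<tau> h y = pd \<tau> g x + (1/2) *\<^sub>R ((\<Sum>\<sigma>\<in>UNIV. (y - x) $ \<sigma> *\<^sub>R w \<sigma> \<tau>) + (\<Sum>\<nu>\<in>UNIV. (y - x) $ \<nu> *\<^sub>R w \<tau> \<nu>))"
    proof -
      have 1: "(\<Sum>\<sigma>\<in>UNIV. axis \<tau> 1 $ \<sigma> *\<^sub>R pd \<sigma> g x) = pd \<tau> g x"
        by (simp add: axis_def if_distrib[of "\<lambda>c. c *\<^sub>R _"] cong: if_cong)
      have 2: "(\<Sum>\<nu>\<in>UNIV. ((y - x) $ \<sigma> * axis \<tau> 1 $ \<nu>) *\<^sub>R w \<sigma> \<nu>) = (y - x) $ \<sigma> *\<^sub>R w \<sigma> \<tau>" for \<sigma>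
        by (simp add: axis_def if_distrib[of "\<lambda>c. (_ * c) *\<^sub>R _"] cong: if_cong)
      have 3: "(\<Sum>\<sigma>\<in>UNIV. \<Sum>\<nu>\<in>UNIV. (axis \<tau> 1 $ \<sigma> * (y - x) $ \<nu>) *\<^sub>R w \<sigma> \<nu>)
          = (\<Sum>\<nu>\<in>UNIV. (y - x) $ \<nu> *\<^sub>R w \<tau> \<nu>)"
        by (subst sum.swap)
          (simp add: axis_def if_distrib[of "\<lambda>c. (c * _) *\<^sub>R _"] cong: if_cong)
      show ?thesis
        unfolding has_derivative_pd[OF h'] scaleR_add_left sum.distrib 1 2 3 ..
    qed
    also have "\<dots> = pd \<tau> g x + (\<Sum>\<sigma>\<in>UNIV. (y - x) $ \<sigma> *\<^sub>R w \<sigma> \<tau>)"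
      by (simp add: w_sym[of \<tau>] flip: scaleR_2)
    finally show "pd \<tau> h y = pd \<tau> g x + (\<Sum>\<sigma>\<in>UNIV. (y - x) $ \<sigma> *\<^sub>R w \<sigma> \<tau>)" .
  qed
  have pd_h': "(pd \<tau> h has_derivative (\<lambda>k. \<Sum>\<sigma>\<in>UNIV. k $ \<sigma> *\<^sub>R w \<sigma> \<tau>)) (at y)" for \<tau> y
    unfolding pd_h by (rule derivative_eq_intros refl lin)+ (simp add: fun_eq_iff)
  show "h x = g x" by (simp add: h)
  show "pd \<sigma> h x = pd \<sigma> g x" by (simp add: pd_h)
  show "pd \<sigma> (pd \<nu> h) x = pd \<sigma> (pd \<nu> g) x"
    unfolding has_derivative_pd[OF pd_h'] w_def
    by (simp add: axis_def if_distrib[of "\<lambda>c. c *\<^sub>R _"] cong: if_cong)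
  show "twice_differentiable h x"
    unfolding twice_differentiable_def
    using differentiableI[OF h'] differentiableI[OF pd_h'] by simp
qed

section \<open>Contraction and exterior product in coordinates\<close>

text \<open>A determinant indexed by list positions, because \<open>wedge\<close> and
  \<open>wedge_list\<close> number factors and arguments by position, whereas \<open>det\<close> is
  indexed by the coordinate type.\<close>

definition nat_det :: "nat \<Rightarrow> (nat \<Rightarrow> nat \<Rightarrow> real) \<Rightarrow> real" where
  "nat_det n M = (\<Sum>\<pi> | \<pi> permutes {..<n}. of_int (sign \<pi>) * (\<Prod>i<n. M i (\<pi> i)))"

lemma nat_det_cong:
  assumes "\<And>i j. i < n \<Longrightarrow> j < n \<Longrightarrow> M i j = N i j"
  shows "nat_det n M = nat_det n N"
  unfolding nat_det_def
proof (intro sum.cong refl arg_cong2[of _ _ _ _ "(*)"] prod.cong)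
  fix \<pi> i assume "\<pi> \<in> {\<pi>. \<pi> permutes {..<n}}" "i \<in> {..<n}"
  then have "\<pi> i < n" "i < n" using permutes_in_image[of \<pi> "{..<n}" i] by auto
  then show "M i (\<pi> i) = N i (\<pi> i)" using assms by blast
qed

lemma nat_det_permute:
  assumes "\<tau> permutes {..<n}"
  shows "nat_det n (\<lambda>i j. M i (\<tau> j)) = of_int (sign \<tau>) * nat_det n M"
proof -
  have perm: "permutation \<pi>" if "\<pi> permutes {..<n}" for \<pi>
    using that permutes_imp_permutation by blast
  have "nat_det n (\<lambda>i j. M i (\<tau> j)) = 
      (\<Sum>\<pi> | \<pi> permutes {..<n}. of_int (sign \<tau>) * (of_int (sign (\<tau> \<circ> \<pi>)) * (\<Prod>i<n. M i ((\<tau> \<circ> \<pi>) i))))"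
    unfolding nat_det_def
  proof (intro sum.cong refl)
    fix \<pi> assume "\<pi> \<in> {\<pi>. \<pi> permutes {..<n}}"
    then have "sign (\<tau> \<circ> \<pi>) = sign \<tau> * sign \<pi>"
      using assms perm by (simp add: sign_compose)
    then have "sign \<pi> = sign \<tau> * sign (\<tau> \<circ> \<pi>)" by simp
    then show "of_int (sign \<pi>) * (\<Prod>i<n. M i (\<tau> (\<pi> i))) =
        of_int (sign \<tau>) * (of_int (sign (\<tau> \<circ> \<pi>)) * (\<Prod>i<n. M i ((\<tau> \<circ> \<pi>) i)))"
      by (simp add: mult.assoc flip: of_int_mult)
  qed
  also have "\<dots> = of_int (sign \<tau>) * nat_det n M"
    unfolding nat_det_def sum_distrib_left[symmetric]
    by (subst setum_permutations_compose_left[OF assms]) simp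
  finally show ?thesis .
qed

lemma nat_det_equal_columns:
  assumes "a < n" "b < n" "a \<noteq> b" "\<And>i. M i a = M i b"
  shows "nat_det n M = 0"
proof -
  have "nat_det n M = nat_det n (\<lambda>i j. M i (Transposition.transpose a b j))"
    by (rule nat_det_cong) (auto simp: Transposition.transpose_def assms(4))
  also have "\<dots> = - nat_det n M"
    using assms by (subst nat_det_permute) (auto intro: permutes_swap_id simp: sign_swap_id)
  finally show ?thesis by simp
qed

lemma nat_det_sum_column:
  assumes "b < n"
  shows "nat_det n (\<lambda>i j. if j = b then \<Sum>a\<in>S. c a * N a i else M i j) =
     (\<Sum>a\<in>S. c a * nat_det n (\<lambda>i j. if j = b then N a i else M i j))"
proof -
  \<comment> \<open>In each Leibniz product exactly one factor comes from column \<open>b\<close>,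
    the one in row \<open>inv \<pi> b\<close>. Isolating it makes the linearity in that column
    visible.\<close>
  have eq: "(\<Prod>i<n. if \<pi> i = b then f i else M i (\<pi> i)) =
      f (inv \<pi> b) * (\<Prod>i\<in>{..<n} - {inv \<pi> b}. M i (\<pi> i))"
    if "\<pi> permutes {..<n}" for \<pi> and f :: "nat \<Rightarrow> real"
  proof -
    have b: "inv \<pi> b \<in> {..<n}" "\<pi> (inv \<pi> b) = b"
      using that assms permutes_in_image[OF permutes_inv[OF that], of b] permutes_inverses(1)[OF that]
      by auto
    have "(\<Prod>i<n. if \<pi> i = b then f i else M i (\<pi> i)) =
        f (inv \<pi> b) * (\<Prod>i\<in>{..<n} - {inv \<pi> b}. if \<pi> i = b then f i else M i (\<pi> i))"
      using prod.remove[OF _ b(1), of "\<lambda>i. if \<pi> i = b then f i else M i (\<pi> i)"] b(2) by simp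
    also have "(\<Prod>i\<in>{..<n} - {inv \<pi> b}. if \<pi> i = b then f i else M i (\<pi> i)) =
        (\<Prod>i\<in>{..<n} - {inv \<pi> b}. M i (\<pi> i))"
      by (intro prod.cong refl) (use permutes_inverses(2)[OF that] in auto)
    finally show ?thesis .
  qed
  have "nat_det n (\<lambda>i j. if j = b then \<Sum>a\<in>S. c a * N a i else M i j) =
     (\<Sum>\<pi> | \<pi> permutes {..<n}. \<Sum>a\<in>S. of_int (sign \<pi>) *
       ((c a * N a (inv \<pi> b)) * (\<Prod>i\<in>{..<n} - {inv \<pi> b}. M i (\<pi> i))))"
    unfolding nat_det_def by (intro sum.cong refl) (simp add: eq sum_distrib_left sum_distrib_right)
  also have "\<dots> = (\<Sum>a\<in>S. c a * nat_det n (\<lambda>i j. if j = b then N a i else M i j))"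
    unfolding nat_det_def sum_distrib_left
    by (subst sum.swap) (intro sum.cong refl, simp add: eq mult_ac)
  finally show ?thesis .
qed

text \<open>Relabelling by \<open>l\<close> maps the permutations of positions bijectively to those
  of the coordinate type, preserving signs and the Leibniz products.\<close>

lemma nat_det_eq_det:
  fixes A :: "real^'m^'m"
  assumes l: "bij_betw l {..<n} (UNIV :: 'm set)"
  shows "nat_det n (\<lambda>i j. A $ l i $ l j) = det A"
proof -
  have inj: "inj_on l {..<n}" using l bij_betw_def by blast
  have "det A = (\<Sum>\<pi> | \<pi> permutes {..<n}. of_int (sign (map_permutation {..<n} l \<pi>)) *
      (\<Prod>i\<in>UNIV. A $ i $ map_permutation {..<n} l \<pi> i))"
    unfolding det_def
  proof (rule sum.reindex_bij_witness[where i = "map_permutation {..<n} l"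
        and j = "map_permutation UNIV (inv_into {..<n} l)"], goal_cases)
    case (1 p)
    then show ?case
      by (intro map_permutation_compose_inv[OF bij_betw_inv_into[OF l]])
        (auto simp: bij_betw_inv_into_right[OF l])
  next
    case (2 p)
    then show ?case using map_permutation_permutes[OF bij_betw_inv_into[OF l]] by auto
  next
    case (3 \<pi>)
    then show ?case
      by (intro map_permutation_compose_inv[OF l]) (auto simp: bij_betw_inv_into_left[OF l])
  next
    case (4 \<pi>)
    then show ?case using map_permutation_permutes[OF l] by auto
  next
    case (5 p)
    then have "map_permutation {..<n} l (map_permutation UNIV (inv_into {..<n} l) p) = p"
      by (intro map_permutation_compose_inv[OF bij_betw_inv_into[OF l]])
        (auto simp: bij_betw_inv_into_right[OF l])
    then show ?case by simp
  qed
  also have "\<dots> = nat_det n (\<lambda>i j. A $ l i $ l j)"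
    unfolding nat_det_def
  proof (intro sum.cong refl)
    fix \<pi> assume "\<pi> \<in> {\<pi>. \<pi> permutes {..<n}}"
    then have \<pi>: "\<pi> permutes {..<n}" by simp
    have "(\<Prod>i\<in>UNIV. A $ i $ map_permutation {..<n} l \<pi> i) =
        (\<Prod>i<n. A $ l i $ map_permutation {..<n} l \<pi> (l i))"
      by (rule prod.reindex_bij_betw[OF l, symmetric])
    also have "\<dots> = (\<Prod>i<n. A $ l i $ l (\<pi> i))"
      by (intro prod.cong refl) (simp add: map_permutation_apply[OF inj])
    finally show "of_int (sign (map_permutation {..<n} l \<pi>)) *
        (\<Prod>i\<in>UNIV. A $ i $ map_permutation {..<n} l \<pi> i) =
        of_int (sign \<pi>) * (\<Prod>i<n. A $ l i $ l (\<pi> i))"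
      using sign_map_permutation[OF inj \<pi>] by simp
  qed
  finally show ?thesis by simp
qed

text \<open>The shift by two is the square of a cyclic shift, hence even for every \<open>k\<close>.
  It reconciles two conventions: contraction puts its vectors into slots 0 and 1, while the exterior
  product hands the last two arguments to the 2-form.\<close>

lemma ex_even_shift_by_two:
  obtains \<rho> where "\<rho> permutes {..<Suc (Suc k)}" "sign \<rho> = 1" "\<rho> 0 = k" "\<rho> (Suc 0) = Suc k"
    "\<And>j. j < k \<Longrightarrow> \<rho> (Suc (Suc j)) = j"
proof -
  define c where "c j = (if j < Suc (Suc k) then if j = 0 then Suc k else j - 1 else j)" for j
  define d where "d j = (if j < Suc (Suc k) then if j = Suc k then 0 else Suc j else j)" for j
  have bij: "bij_betw c {..<Suc (Suc k)} {..<Suc (Suc k)}"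
    by (rule bij_betw_byWitness[where f' = d]) (auto simp: c_def d_def)
  have "c j = j" if "j \<notin> {..<Suc (Suc k)}" for j using that by (simp add: c_def)
  with bij have c: "c permutes {..<Suc (Suc k)}" by (rule bij_imp_permutes)
  show thesis
  proof (rule that[of "c \<circ> c"])
    show "c \<circ> c permutes {..<Suc (Suc k)}" by (rule permutes_compose[OF c c])
    have "permutation c" using c permutes_imp_permutation by blast
    then show "sign (c \<circ> c) = 1" by (simp add: sign_compose)
  qed (auto simp: c_def)
qed

text \<open>Composing with one permutation that has the prescribed last two values leaves exactly
  the permutations of the first \<open>k\<close> positions. The count cancels the factor
  \<open>fact k\<close> in the normalisation of \<open>wedge\<close>.\<close>

lemma card_permutes_fixed_tail:
  assumes "a < Suc (Suc k)" "b < Suc (Suc k)" "a \<noteq> b"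
  shows "card {\<pi>. \<pi> permutes {..<Suc (Suc k)} \<and> \<pi> k = a \<and> \<pi> (Suc k) = b} = fact k"
proof -
  \<comment> \<open>The first transposition sends \<open>k\<close> to \<open>a\<close>. The second
    moves the image of \<open>Suc k\<close> to \<open>b\<close> and leaves \<open>a\<close> alone,
    since \<open>a\<close> differs from both points that it exchanges.\<close>
  define \<tau>1 where "\<tau>1 = Transposition.transpose k a"
  define \<tau> where "\<tau> = Transposition.transpose b (\<tau>1 (Suc k)) \<circ> \<tau>1"
  have \<tau>1: "\<tau>1 permutes {..<Suc (Suc k)}"
    unfolding \<tau>1_def using assms by (intro permutes_swap_id) auto
  have "\<tau>1 (Suc k) < Suc (Suc k)" using permutes_in_image[OF \<tau>1, of "Suc k"] by simp
  then have \<tau>: "\<tau> permutes {..<Suc (Suc k)}"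
    unfolding \<tau>_def using \<tau>1 assms by (intro permutes_compose permutes_swap_id) auto
  have \<tau>_k: "\<tau> k = a" "\<tau> (Suc k) = b"
    using assms by (auto simp: \<tau>_def \<tau>1_def Transposition.transpose_def)
  have "bij_betw (\<lambda>\<rho>. \<tau> \<circ> \<rho>) {\<rho>. \<rho> permutes {..<k}}
      {\<pi>. \<pi> permutes {..<Suc (Suc k)} \<and> \<pi> k = a \<and> \<pi> (Suc k) = b}"
  proof (rule bij_betw_byWitness[where f' = "\<lambda>\<pi>. inv \<tau> \<circ> \<pi>"])
    show "\<forall>\<rho>\<in>{\<rho>. \<rho> permutes {..<k}}. inv \<tau> \<circ> (\<tau> \<circ> \<rho>) = \<rho>"
      by (simp add: o_assoc permutes_inv_o[OF \<tau>])
    show "\<forall>\<pi>\<in>{\<pi>. \<pi> permutes {..<Suc (Suc k)} \<and> \<pi> k = a \<and> \<pi> (Suc k) = b}. \<tau> \<circ> (inv \<tau> \<circ> \<pi>) = \<pi>"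
      by (simp add: o_assoc permutes_inv_o[OF \<tau>])
    show "(\<lambda>\<rho>. \<tau> \<circ> \<rho>) ` {\<rho>. \<rho> permutes {..<k}} \<subseteq>
        {\<pi>. \<pi> permutes {..<Suc (Suc k)} \<and> \<pi> k = a \<and> \<pi> (Suc k) = b}"
    proof (safe)
      fix \<rho> assume \<rho>: "\<rho> permutes {..<k}"
      then have "\<rho> permutes {..<Suc (Suc k)}" by (rule permutes_subset) auto
      then show "\<tau> \<circ> \<rho> permutes {..<Suc (Suc k)}" using \<tau> permutes_compose by blast
      show "(\<tau> \<circ> \<rho>) k = a" "(\<tau> \<circ> \<rho>) (Suc k) = b"
        using permutes_not_in[OF \<rho>, of k] permutes_not_in[OF \<rho>, of "Suc k"] \<tau>_k by auto
    qed
    show "(\<lambda>\<pi>. inv \<tau> \<circ> \<pi>) ` {\<pi>. \<pi> permutes {..<Suc (Suc k)} \<and> \<pi> k = a \<and> \<pi> (Suc k) = b}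
        \<subseteq> {\<rho>. \<rho> permutes {..<k}}"
    proof (safe)
      fix \<pi> assume \<pi>: "\<pi> permutes {..<Suc (Suc k)}" "a = \<pi> k" "b = \<pi> (Suc k)"
      have 1: "inv \<tau> \<circ> \<pi> permutes {..<Suc (Suc k)}"
        by (intro permutes_compose \<pi> permutes_inv \<tau>)
      have 2: "inv \<tau> a = k" "inv \<tau> b = Suc k"
        using permutes_inverses(2)[OF \<tau>, of k] permutes_inverses(2)[OF \<tau>, of "Suc k"] \<tau>_k by auto
      show "inv \<tau> \<circ> \<pi> permutes {..<k}"
      proof (rule permutes_superset[OF 1])
        fix x assume "x \<in> {..<Suc (Suc k)} - {..<k}"
        then have "x = k \<or> x = Suc k" by auto
        then show "(inv \<tau> \<circ> \<pi>) x = x" using 2 \<pi>(2,3) by auto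
      qed
    qed
  qed
  then have "card {\<pi>. \<pi> permutes {..<Suc (Suc k)} \<and> \<pi> k = a \<and> \<pi> (Suc k) = b} =
      card {\<rho>. \<rho> permutes {..<k}}"
    by (simp add: bij_betw_same_card)
  also have "\<dots> = fact k" by (rule card_permutations) auto
  finally show ?thesis .
qed

text \<open>A permutation contributes only if it gives the vectors \<open>a\<close> and
  \<open>b\<close> to the 2-form; otherwise one of them occurs twice among the columns of the
  determinant. For \<open>a \<noteq> b\<close> the two orders of \<open>a\<close>, \<open>b\<close>
  account for \<open>fact k\<close> permutations each, and all contribute equally: the sign of the
  permutation appears twice, and exchanging \<open>a\<close> and \<open>b\<close> changes the sign
  of both the determinant and \<beta>.\<close>

lemma contraction_wedge_basis:
  fixes \<beta> :: "nat \<Rightarrow> nat \<Rightarrow> real"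
  assumes ab: "a < Suc (Suc k)" "b < Suc (Suc k)" and anti: "\<And>a b. \<beta> b a = - \<beta> a b"
  shows "(\<Sum>\<pi> | \<pi> permutes {..<Suc (Suc k)}. of_int (sign \<pi>) *
      nat_det (Suc (Suc k)) (\<lambda>i j. if j = 0 then N i a else if j = 1 then N i b else N i (\<pi> (j - 2)))
      * \<beta> (\<pi> k) (\<pi> (Suc k))) = 2 * fact k * \<beta> a b * nat_det (Suc (Suc k)) N" (is "?lhs = _")
proof -
  let ?n = "Suc (Suc k)"
  let ?D = "\<lambda>\<pi>. nat_det ?n (\<lambda>i j. if j = 0 then N i a else if j = 1 then N i b else N i (\<pi> (j - 2)))"
  obtain \<rho> where \<rho>: "\<rho> permutes {..<?n}" "sign \<rho> = 1" "\<rho> 0 = k" "\<rho> (Suc 0) = Suc k"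
    "\<And>j. j < k \<Longrightarrow> \<rho> (Suc (Suc j)) = j"
    by (rule ex_even_shift_by_two[of k]) (rule that)
  have \<rho>': "\<rho> j = j - 2" if "j \<noteq> 0" "j \<noteq> 1" "j < ?n" for j
  proof -
    have "j = Suc (Suc (j - 2))" using that by simp
    then show ?thesis using \<rho>(5)[of "j - 2"] that by simp
  qed
  have perm: "permutation \<pi>" if "\<pi> permutes {..<?n}" for \<pi>
    using that permutes_imp_permutation by blast
  have D1: "?D \<pi> = of_int (sign \<pi>) * nat_det ?n N"
    if \<pi>: "\<pi> permutes {..<?n}" "\<pi> k = a" "\<pi> (Suc k) = b" for \<pi>
  proof -
    have "?D \<pi> = nat_det ?n (\<lambda>i j. N i ((\<pi> \<circ> \<rho>) j))"
      by (rule nat_det_cong) (auto simp: \<rho>(3) \<rho>(4)[simplified] \<rho>' \<pi>)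
    also have "\<dots> = of_int (sign (\<pi> \<circ> \<rho>)) * nat_det ?n N"
      by (intro nat_det_permute permutes_compose \<rho> \<pi>)
    also have "sign (\<pi> \<circ> \<rho>) = sign \<pi>"
      using \<rho>(2) by (simp add: sign_compose perm \<pi>(1) \<rho>(1))
    finally show ?thesis .
  qed
  have D2: "?D \<pi> = - of_int (sign \<pi>) * nat_det ?n N"
    if \<pi>: "\<pi> permutes {..<?n}" "\<pi> k = b" "\<pi> (Suc k) = a" for \<pi>
  proof -
    \<comment> \<open>Columns 0 and 1 now hold the last two values of \<pi> in reversed order, which
      costs one transposition and thus a sign.\<close>
    have t: "Transposition.transpose 0 1 permutes {..<?n}" by (rule permutes_swap_id) auto
    have "?D \<pi> = nat_det ?n (\<lambda>i j. N i ((\<pi> \<circ> (\<rho> \<circ> Transposition.transpose 0 1)) j))"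
      by (rule nat_det_cong) (auto simp: \<rho>(3) \<rho>(4)[simplified] \<rho>' \<pi> Transposition.transpose_def)
    also have "\<dots> = of_int (sign (\<pi> \<circ> (\<rho> \<circ> Transposition.transpose 0 1))) * nat_det ?n N"
      by (intro nat_det_permute permutes_compose \<rho> \<pi> t)
    also have "sign (\<pi> \<circ> (\<rho> \<circ> Transposition.transpose 0 1)) = - sign \<pi>"
      using \<rho>(2) perm[OF \<rho>(1)] perm[OF t] perm[OF \<pi>(1)]
      by (simp add: sign_compose permutation_compose sign_swap_id)
    finally show ?thesis by simp
  qed
  have D3: "?D \<pi> = 0"
    if \<pi>: "\<pi> permutes {..<?n}" and no: "\<not> (\<pi> k = a \<and> \<pi> (Suc k) = b)" "\<not> (\<pi> k = b \<and> \<pi> (Suc k) = a)" for \<pi>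
  proof (cases "a = b")
    case True
    then show ?thesis by (intro nat_det_equal_columns[of 0 _ 1]) auto
  next
    case False
    \<comment> \<open>A value not taken at the last two positions is taken earlier, so a vector that
      misses the 2-form repeats column 0 or 1.\<close>
    have ex: "\<exists>j<k. \<pi> j = c" if "c < ?n" "c \<noteq> \<pi> k" "c \<noteq> \<pi> (Suc k)" for c
    proof -
      have "inv \<pi> c < ?n" using permutes_in_image[OF permutes_inv[OF \<pi>], of c] that by auto
      moreover have "\<pi> (inv \<pi> c) = c" using permutes_inverses(1)[OF \<pi>] .
      ultimately show ?thesis using that by (metis less_SucE)
    qed
    have "\<pi> k \<noteq> \<pi> (Suc k)" using permutes_inj[OF \<pi>] by (metis injD n_not_Suc_n)
    then consider "a \<noteq> \<pi> k" "a \<noteq> \<pi> (Suc k)" | "b \<noteq> \<pi> k" "b \<noteq> \<pi> (Suc k)"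
      using no False by metis
    then show ?thesis
    proof cases
      case 1
      then obtain j where "j < k" "\<pi> j = a" using ex ab by blast
      then show ?thesis by (intro nat_det_equal_columns[of 0 _ "j + 2"]) auto
    next
      case 2
      then obtain j where "j < k" "\<pi> j = b" using ex ab by blast
      then show ?thesis by (intro nat_det_equal_columns[of 1 _ "j + 2"]) auto
    qed
  qed
  let ?A = "{\<pi>. \<pi> permutes {..<?n} \<and> \<pi> k = a \<and> \<pi> (Suc k) = b}"
  let ?B = "{\<pi>. \<pi> permutes {..<?n} \<and> \<pi> k = b \<and> \<pi> (Suc k) = a}"
  let ?f = "\<lambda>\<pi>. of_int (sign \<pi>) * ?D \<pi> * \<beta> (\<pi> k) (\<pi> (Suc k))"
  show ?thesis
  proof (cases "a = b")
    case True
    then have "?lhs = 0"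
      by (intro sum.neutral ballI) (auto intro!: nat_det_equal_columns[of 0 _ 1])
    moreover have "\<beta> a b = 0" using anti[of a b] True by simp
    ultimately show ?thesis by simp
  next
    case False
    have fin: "finite {\<pi>. \<pi> permutes {..<?n}}" by (rule finite_permutations) simp
    have AB: "?A \<union> ?B \<subseteq> {\<pi>. \<pi> permutes {..<?n}}" "?A \<inter> ?B = {}" using False by auto
    have finAB: "finite ?A" "finite ?B" by (auto intro: finite_subset[OF _ fin])
    have "?lhs = sum ?f (?A \<union> ?B)"
      using fin AB D3 by (intro sum.mono_neutral_right) auto
    also have "\<dots> = sum ?f ?A + sum ?f ?B"
      by (rule sum.union_disjoint[OF finAB AB(2)])
    also have "sum ?f ?A = (\<Sum>\<pi>\<in>?A. \<beta> a b * nat_det ?n N)"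
    proof (intro sum.cong refl)
      fix \<pi> assume "\<pi> \<in> ?A"
      then have \<pi>: "\<pi> permutes {..<?n}" "\<pi> k = a" "\<pi> (Suc k) = b" by auto
      have "real_of_int (sign \<pi>) * of_int (sign \<pi>) = 1" by (simp flip: of_int_mult)
      then show "?f \<pi> = \<beta> a b * nat_det ?n N" unfolding D1[OF \<pi>] \<pi>(2,3) by algebra
    qed
    also have "sum ?f ?B = (\<Sum>\<pi>\<in>?B. \<beta> a b * nat_det ?n N)"
    proof (intro sum.cong refl)
      fix \<pi> assume "\<pi> \<in> ?B"
      then have \<pi>: "\<pi> permutes {..<?n}" "\<pi> k = b" "\<pi> (Suc k) = a" by auto
      have "real_of_int (sign \<pi>) * of_int (sign \<pi>) = 1" by (simp flip: of_int_mult)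
      then show "?f \<pi> = \<beta> a b * nat_det ?n N" unfolding D2[OF \<pi>] \<pi>(2,3) anti[of a b] by algebra
    qed
    finally show ?thesis
      using card_permutes_fixed_tail[OF ab False] card_permutes_fixed_tail[OF ab(2,1)] False by simp
  qed
qed

text \<open>Bilinearity in the two contracted vectors reduces the claim to basis vectors. With
  \<open>N\<close> the values of the coframe on the arguments, it says \<open>(d \<lrcorner> (c
  \<lrcorner> \<theta>0)) \<and> \<beta> = \<beta>(c, d) \<theta>0\<close>; the divisor is the
  normalisation of \<open>wedge\<close> for degrees \<open>k\<close> and 2.\<close>

lemma contraction_wedge:
  fixes \<beta> :: "nat \<Rightarrow> nat \<Rightarrow> real" and k :: nat
  defines "n \<equiv> Suc (Suc k)"
  assumes anti: "\<And>a b. \<beta> b a = - \<beta> a b"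
  shows "(\<Sum>\<pi> | \<pi> permutes {..<n}. of_int (sign \<pi>) *
      nat_det n (\<lambda>i j. if j = 0 then \<Sum>a<n. c a * N i a else if j = 1 then \<Sum>b<n. d b * N i b
        else N i (\<pi> (j - 2)))
      * \<beta> (\<pi> k) (\<pi> (Suc k))) / (fact k * 2) = (\<Sum>a<n. \<Sum>b<n. c a * d b * \<beta> a b) * nat_det n N"
proof -
  let ?D = "\<lambda>a b \<pi>. nat_det n (\<lambda>i j. if j = 0 then N i a else if j = 1 then N i b else N i (\<pi> (j - 2)))"
  have expand: "nat_det n (\<lambda>i j. if j = 0 then \<Sum>a<n. c a * N i a else if j = 1 then \<Sum>b<n. d b * N i b
      else N i (\<pi> (j - 2))) = (\<Sum>a<n. \<Sum>b<n. c a * d b * ?D a b \<pi>)" for \<pi> :: "nat \<Rightarrow> nat"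
  proof -
    have "nat_det n (\<lambda>i j. if j = 0 then \<Sum>a<n. c a * N i a else if j = 1 then \<Sum>b<n. d b * N i b
        else N i (\<pi> (j - 2))) = (\<Sum>a<n. c a * nat_det n (\<lambda>i j. if j = 0 then N i a
        else if j = 1 then \<Sum>b<n. d b * N i b else N i (\<pi> (j - 2))))"
      by (rule nat_det_sum_column) (simp add: n_def)
    also have "\<dots> = (\<Sum>a<n. c a * nat_det n (\<lambda>i j. if j = 1 then \<Sum>b<n. d b * N i b
        else if j = 0 then N i a else N i (\<pi> (j - 2))))"
      by (intro sum.cong refl arg_cong2[of _ _ _ _ "(*)"] nat_det_cong) auto
    also have "\<dots> = (\<Sum>a<n. c a * (\<Sum>b<n. d b * nat_det n (\<lambda>i j. if j = 1 then N i b
        else if j = 0 then N i a else N i (\<pi> (j - 2)))))"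
      by (subst nat_det_sum_column) (simp_all add: n_def)
    also have "\<dots> = (\<Sum>a<n. c a * (\<Sum>b<n. d b * ?D a b \<pi>))"
      by (intro sum.cong refl arg_cong2[of _ _ _ _ "(*)"] nat_det_cong) auto
    finally show ?thesis by (simp add: sum_distrib_left mult.assoc)
  qed
  have "(\<Sum>\<pi> | \<pi> permutes {..<n}. of_int (sign \<pi>) * (\<Sum>a<n. \<Sum>b<n. c a * d b * ?D a b \<pi>)
      * \<beta> (\<pi> k) (\<pi> (Suc k))) =
    (\<Sum>\<pi> | \<pi> permutes {..<n}. \<Sum>a<n. \<Sum>b<n. c a * d b * (of_int (sign \<pi>) * ?D a b \<pi> * \<beta> (\<pi> k) (\<pi> (Suc k))))"
    by (simp add: sum_distrib_left sum_distrib_right mult_ac)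
  also have "\<dots> = (\<Sum>a<n. \<Sum>b<n. \<Sum>\<pi> | \<pi> permutes {..<n}.
      c a * d b * (of_int (sign \<pi>) * ?D a b \<pi> * \<beta> (\<pi> k) (\<pi> (Suc k))))"
    by (subst sum.swap) (intro sum.cong refl sum.swap)
  also have "\<dots> = (\<Sum>a<n. \<Sum>b<n. c a * d b * (2 * fact k * \<beta> a b * nat_det n N))"
    unfolding sum_distrib_left[symmetric]
    by (intro sum.cong refl arg_cong2[of _ _ _ _ "(*)"], unfold n_def)
      (rule contraction_wedge_basis, auto intro: anti)
  also have "\<dots> = (\<Sum>a<n. \<Sum>b<n. c a * d b * \<beta> a b) * nat_det n N * (fact k * 2)"
    by (simp add: sum_distrib_left sum_distrib_right mult_ac)
  finally show ?thesis unfolding expand by simp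
qed

section \<open>Exterior products evaluated on lifts of the coordinate vectors\<close>

definition idx :: "nat \<Rightarrow> 'm::{finite,linorder}" where
  "idx i = sorted_list_of_set UNIV ! i"

lemma bij_idx: "bij_betw idx {..<CARD('m)} (UNIV :: 'm::{finite,linorder} set)"
  unfolding idx_def[abs_def] by (rule bij_betw_nth) auto

lemma sum_idx: "(\<Sum>a<CARD('m). f (idx a)) = (\<Sum>\<mu>\<in>(UNIV :: 'm::{finite,linorder} set). f \<mu>)"
  by (rule sum.reindex_bij_betw[OF bij_idx])

lemma wedge_list_eq:
  "length vs = length \<alpha>s \<Longrightarrow> wedge_list \<alpha>s x vs = nat_det (length \<alpha>s) (\<lambda>i j. (\<alpha>s ! i) x [vs ! j])"
  by (simp add: wedge_list_def nat_det_def)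

lemma theta0_eq:
  fixes p :: "('m::{finite,linorder} mat, 'm) j1"
  assumes "length vs = CARD('m)"
  shows "theta0 p vs = nat_det CARD('m) (\<lambda>i j. (matrix_inv (frame_of p) *v fst (vs ! j)) $ idx i)"
  unfolding theta0_def
  by (subst wedge_list_eq) (auto simp: assms idx_def theta_def intro!: nat_det_cong)

lemma theta0_length: "length vs \<noteq> CARD('m) \<Longrightarrow> theta0 (p :: ('m::{finite,linorder} mat, 'm) j1) vs = 0"
  by (simp add: theta0_def wedge_list_def)

lemma volume_form_basis:
  fixes vs :: "((real^'m::{finite,linorder}) \<times> 'b) list"
  assumes "length vs = CARD('m)" "\<And>j. j < CARD('m) \<Longrightarrow> fst (vs ! j) = axis (idx j) 1"
  shows "volume_form p vs = 1"
proof -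
  have "volume_form p vs = nat_det CARD('m) (\<lambda>i j. (mat 1 :: 'm mat) $ idx i $ idx j)"
    unfolding volume_form_def
    by (subst wedge_list_eq)
      (auto simp: assms idx_def[symmetric] axis_def mat_def intro!: nat_det_cong)
  then show ?thesis by (simp add: nat_det_eq_det[OF bij_idx])
qed

text \<open>Only the values of \<alpha> on pairs from \<open>ws\<close> matter; they are collected
  in the table \<beta>. The order of contractions in \<open>theta2 i k\<close> puts the frame vector
  \<open>k\<close> before \<open>i\<close>, and \<open>det (matrix_inv e)\<close> is
  \<open>theta0\<close> on \<open>ws\<close>.\<close>

lemma wedge_theta2:
  fixes p :: "('m::{finite,linorder} mat, 'm) j1" and \<beta> :: "nat \<Rightarrow> nat \<Rightarrow> real"
  defines "e \<equiv> frame_of p"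
  assumes ws: "length ws = CARD('m)" "\<And>a. a < CARD('m) \<Longrightarrow> fst (ws ! a) = axis (idx a) 1"
    and \<beta>: "\<And>a b. a < CARD('m) \<Longrightarrow> b < CARD('m) \<Longrightarrow> \<alpha> p [ws ! a, ws ! b] = \<beta> a b"
    and anti: "\<And>a b. \<beta> b a = - \<beta> a b"
  shows "wedge (CARD('m) - 2) 2 (theta2 i k) \<alpha> p ws =
     (\<Sum>a<CARD('m). \<Sum>b<CARD('m). e $ idx a $ k * e $ idx b $ i * \<beta> a b) * det (matrix_inv e)"
proof (cases "CARD('m) = 1")
  \<comment> \<open>In dimension one \<open>CARD('m) - 2\<close> truncates to 0. The left side
    vanishes by the length convention of \<open>wedge_list\<close>, the right side because \<beta>
    is antisymmetric.\<close>
  case True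
  then have "wedge (CARD('m) - 2) 2 (theta2 i k) \<alpha> p ws = 0"
    by (simp add: wedge_def theta2_def contract_def theta0_length)
  moreover have "\<beta> 0 0 = 0" using anti[of 0 0] by simp
  ultimately show ?thesis using True by simp
next
  case False
  have "CARD('m) \<noteq> 0" by simp
  then obtain n where n: "CARD('m) = Suc (Suc n)"
    using False by (metis One_nat_def not0_implies_Suc)
  define E where "E = matrix_inv e"
  define N where "N i a = E $ idx i $ idx a" for i a
  have col: "(E *v column k e) $ idx i = (\<Sum>a<CARD('m). e $ idx a $ k * N i a)" for i k
    unfolding N_def sum_idx[of "\<lambda>\<mu>. e $ \<mu> $ k * E $ idx i $ \<mu>"]
    by (simp add: matrix_vector_mult_def column_def mult.commute)
  have "wedge (CARD('m) - 2) 2 (theta2 i k) \<alpha> p ws =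
     (\<Sum>\<pi> | \<pi> permutes {..<Suc (Suc n)}. of_int (sign \<pi>) *
        theta2 i k p (map (\<lambda>i. ws ! \<pi> i) [0..<n]) * \<alpha> p [ws ! \<pi> n, ws ! \<pi> (Suc n)]) / (fact n * 2)"
    unfolding wedge_def n by (simp add: upt_rec)
  also have "\<dots> = (\<Sum>\<pi> | \<pi> permutes {..<Suc (Suc n)}. of_int (sign \<pi>) *
      nat_det (Suc (Suc n)) (\<lambda>r j. if j = 0 then \<Sum>a<Suc (Suc n). e $ idx a $ k * N r a
        else if j = 1 then \<Sum>b<Suc (Suc n). e $ idx b $ i * N r b
        else N r (\<pi> (j - 2)))
      * \<beta> (\<pi> n) (\<pi> (Suc n))) / (fact n * 2)"
  proof (intro arg_cong2[of _ _ _ _ "(/)"] refl sum.cong arg_cong2[of _ _ _ _ "(*)"])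
    fix \<pi> assume "\<pi> \<in> {\<pi>. \<pi> permutes {..<Suc (Suc n)}}"
    then have lt: "\<pi> j < Suc (Suc n)" if "j < Suc (Suc n)" for j
      using permutes_in_image[of \<pi> "{..<Suc (Suc n)}" j] that by auto
    then show "\<alpha> p [ws ! \<pi> n, ws ! \<pi> (Suc n)] = \<beta> (\<pi> n) (\<pi> (Suc n))"
      by (intro \<beta>) (simp_all add: n)
    let ?us = "frame_vector k p # frame_vector i p # map (\<lambda>i. ws ! \<pi> i) [0..<n]"
    have "theta2 i k p (map (\<lambda>i. ws ! \<pi> i) [0..<n]) = theta0 p ?us"
      by (simp add: theta2_def contract_def)
    also have "\<dots> = nat_det (Suc (Suc n)) (\<lambda>r j. (E *v fst (?us ! j)) $ idx r)"
      unfolding E_def e_def by (subst theta0_eq) (simp_all add: n)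
    also have "\<dots> = nat_det (Suc (Suc n)) (\<lambda>r j. if j = 0 then \<Sum>a<Suc (Suc n). e $ idx a $ k * N r a
        else if j = 1 then \<Sum>b<Suc (Suc n). e $ idx b $ i * N r b
        else N r (\<pi> (j - 2)))"
    proof (rule nat_det_cong)
      fix r j assume rj: "r < Suc (Suc n)" "j < Suc (Suc n)"
      consider "j = 0" | "j = 1" | j' where "j = Suc (Suc j')" "j' < n"
        using rj by (metis One_nat_def Suc_less_eq not0_implies_Suc)
      then show "(E *v fst (?us ! j)) $ idx r = (if j = 0 then \<Sum>a<Suc (Suc n). e $ idx a $ k * N r a
        else if j = 1 then \<Sum>b<Suc (Suc n). e $ idx b $ i * N r b else N r (\<pi> (j - 2)))"
      proof cases
        case 1
        then show ?thesis
          using col[of k r] by (simp add: frame_vector_def n e_def[symmetric])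
      next
        case 2
        then show ?thesis
          using col[of i r] by (simp add: frame_vector_def n e_def[symmetric])
      next
        case 3
        have "fst (ws ! \<pi> j') = axis (idx (\<pi> j')) 1" using ws(2) lt[of j'] 3 by (simp add: n)
        with 3 show ?thesis
          by (simp add: N_def matrix_vector_mul_component inner_axis)
      qed
    qed
    finally show "theta2 i k p (map (\<lambda>i. ws ! \<pi> i) [0..<n]) = nat_det (Suc (Suc n))
        (\<lambda>r j. if j = 0 then \<Sum>a<Suc (Suc n). e $ idx a $ k * N r a
        else if j = 1 then \<Sum>b<Suc (Suc n). e $ idx b $ i * N r b
        else N r (\<pi> (j - 2)))" .
  qed
  also have "\<dots> = (\<Sum>a<CARD('m). \<Sum>b<CARD('m). e $ idx a $ k * e $ idx b $ i * \<beta> a b) * nat_det CARD('m) N"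
    unfolding n by (rule contraction_wedge[OF anti])
  also have "nat_det CARD('m) N = det E"
    unfolding N_def by (rule nat_det_eq_det[OF bij_idx])
  finally show ?thesis by (simp add: E_def)
qed

section \<open>Torsion, curvature and the Palatini Lagrangian\<close>

lemma ext_deriv_2:
  "ext_deriv \<alpha> p [v, w] =
     frechet_derivative (\<lambda>y. \<alpha> y [w]) (at p) v - frechet_derivative (\<lambda>y. \<alpha> y [v]) (at p) w"
  by (simp add: ext_deriv_def lessThan_Suc)

lemma id_neq_transpose: "id \<noteq> Transposition.transpose (0::nat) 1"
proof
  assume "id = Transposition.transpose (0::nat) 1"
  then have "id (0::nat) = Transposition.transpose 0 1 0" by (rule fun_cong)
  then show False by simp
qed

lemma permutes_lessThan_2: "{\<pi>. \<pi> permutes {..<2::nat}} = {id, Transposition.transpose 0 1}"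
proof (rule card_seteq[symmetric])
  show "finite {\<pi>. \<pi> permutes {..<2::nat}}" by (rule finite_permutations) simp
  show "{id, Transposition.transpose 0 1} \<subseteq> {\<pi>. \<pi> permutes {..<2::nat}}"
    by (auto intro: permutes_id permutes_swap_id)
  have "card {\<pi>. \<pi> permutes {..<2::nat}} = fact 2" by (rule card_permutations) auto
  also have "\<dots> = card {id, Transposition.transpose (0::nat) 1}" using id_neq_transpose by simp
  finally show "card {\<pi>. \<pi> permutes {..<2::nat}} \<le> card {id, Transposition.transpose (0::nat) 1}" by simp
qed

lemma wedge_1_1: "wedge 1 1 \<alpha> \<beta> p [v, w] = \<alpha> p [v] * \<beta> p [w] - \<alpha> p [w] * \<beta> p [v]"
proof -
  have upt: "[0..<1] = [0]" "[1..<2] = [1::nat]" by (simp_all add: upt_rec)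
  show ?thesis
    unfolding wedge_def one_add_one permutes_lessThan_2 upt
    using id_neq_transpose by (simp add: sign_swap_id)
qed

text \<open>The fibre component of \<open>Ts(v)\<close> for a section with derivative
  \<open>z\<close>, that is, what the Cartan form subtracts.\<close>

definition hor :: "'m::finite mat^'m \<Rightarrow> real^'m \<Rightarrow> 'm mat" where
  "hor z v = (\<Sum>\<sigma>\<in>UNIV. v $ \<sigma> *\<^sub>R z $ \<sigma>)"

lemma hor_axis: "hor z (axis \<mu> 1) = z $ \<mu>"
  by (simp add: hor_def axis_def if_distrib[of "\<lambda>c. c *\<^sub>R _"] cong: if_cong)

lemma bounded_linear_hor: "bounded_linear (\<lambda>z. hor z v)"
  unfolding hor_def by (intro bounded_linear_sum bounded_linear_scaleR_right[THEN bounded_linear_compose] bounded_linear_vec_nth)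

lemma cartan_eq: "cartan p v = fst (snd v) - hor (snd (snd p)) (fst v)"
  by (simp add: cartan_def hor_def)

lemma omega_eq: "omega i j p [w] = (matrix_inv (frame_of p) ** cartan p w) $ i $ j"
  by (simp add: omega_def)

lemma frame_of_has_derivative: "(frame_of has_derivative (\<lambda>h. fst (snd h))) (at p)"
  by (intro has_derivative_fst has_derivative_snd has_derivative_ident)

lemma frechet_derivative_omega:
  fixes p :: "('m::finite mat, 'm) j1"
  defines "E \<equiv> matrix_inv (frame_of p)"
  assumes "invertible (frame_of p)"
  shows "frechet_derivative (\<lambda>q. omega i j q [w]) (at p) h =
     (- (E ** hor (snd (snd h)) (fst w)) - E ** fst (snd h) ** E ** cartan p w) $ i $ j"
proof -
  have "((\<lambda>q. cartan q w) has_derivative (\<lambda>h. 0 - hor (snd (snd h)) (fst w))) (at p)"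
    unfolding cartan_eq
    by (intro has_derivative_diff has_derivative_const bounded_linear.has_derivative[OF bounded_linear_hor]
        has_derivative_snd has_derivative_ident)
  from has_derivative_vec_nth[OF has_derivative_vec_nth[OF has_derivative_matrix_mult[OF
      has_derivative_matrix_inv_compose[OF frame_of_has_derivative assms(2)] this]]]
  have "((\<lambda>q. omega i j q [w]) has_derivative
     (\<lambda>h. (- (E ** hor (snd (snd h)) (fst w)) - E ** fst (snd h) ** E ** cartan p w) $ i $ j)) (at p)"
    by (simp add: omega_eq[abs_def] E_def matrix_mult_uminus)
  then show ?thesis by (simp flip: frechet_derivative_at)
qed

text \<open>Splitting each fibre component into its Cartan and horizontal parts cancels all products
  of two Cartan parts: those from \<open>ext_deriv\<close> against those from the exterior square of
  \<open>omega\<close>.\<close>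

lemma Omega_eq:
  fixes p :: "('m::finite mat, 'm) j1"
  defines "E \<equiv> matrix_inv (frame_of p)" and "z \<equiv> snd (snd p)"
  assumes "invertible (frame_of p)"
  shows "Omega i j p [v, w] =
    (E ** (hor z (fst w) ** E ** cartan p v - hor z (fst v) ** E ** cartan p w
         + hor (snd (snd w)) (fst v) - hor (snd (snd v)) (fst w))) $ i $ j"
proof -
  have v: "fst (snd v) = cartan p v + hor z (fst v)" for v
    by (simp add: cartan_eq z_def)
  have "(\<Sum>k\<in>UNIV. wedge 1 1 (omega i k) (omega k j) p [v, w]) =
     (E ** cartan p v ** (E ** cartan p w) - E ** cartan p w ** (E ** cartan p v)) $ i $ j"
    by (simp add: wedge_1_1[unfolded One_nat_def] omega_eq sum_subtractf E_def
        matrix_matrix_mult_def[of "E ** _" "E ** _" for E])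
  then have "Omega i j p [v, w] =
      ((- (E ** hor (snd (snd v)) (fst w)) - E ** fst (snd v) ** E ** cartan p w)
      - (- (E ** hor (snd (snd w)) (fst v)) - E ** fst (snd w) ** E ** cartan p v)
      + (E ** cartan p v ** (E ** cartan p w) - E ** cartan p w ** (E ** cartan p v))) $ i $ j"
    unfolding Omega_def ext_deriv_2 E_def frechet_derivative_omega[OF assms(3)] by simp
  also have "\<dots> = (E ** (hor z (fst w) ** E ** cartan p v - hor z (fst v) ** E ** cartan p w
         + hor (snd (snd w)) (fst v) - hor (snd (snd v)) (fst w))) $ i $ j"
    unfolding v by (simp add: matrix_mult_add matrix_mult_diff matrix_mul_assoc)
  finally show ?thesis .
qed

text \<open>The Cartan parts cancel completely, so the torsion depends only on the base components
  of its arguments. Its vanishing is the coordinate condition that \<open>z $ \<nu> ** E\<close> is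
  symmetric in \<nu> and its column index.\<close>

lemma torsion_eq:
  fixes p :: "('m::finite mat, 'm) j1"
  defines "E \<equiv> matrix_inv (frame_of p)" and "z \<equiv> snd (snd p)"
  assumes "invertible (frame_of p)"
  shows "torsion j p [v, w] = (E *v (hor z (fst w) *v (E *v fst v) - hor z (fst v) *v (E *v fst w))) $ j"
proof -
  have v: "fst (snd v) = cartan p v + hor z (fst v)" for v
    by (simp add: cartan_eq z_def)
  have d: "frechet_derivative (\<lambda>q. theta j q [w]) (at p) = (\<lambda>h. (- (E ** fst (snd h) ** E) *v fst w) $ j)" for w
  proof -
    have "((\<lambda>q. matrix_inv (frame_of q) *v fst w) has_derivative
        (\<lambda>h. E *v 0 + (- (E ** fst (snd h) ** E)) *v fst w)) (at p)"
      unfolding E_def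
      by (intro has_derivative_matrix_vector_mult has_derivative_const
          has_derivative_matrix_inv_compose[OF frame_of_has_derivative assms(3)])
    from has_derivative_vec_nth[OF this]
    have "((\<lambda>q. theta j q [w]) has_derivative (\<lambda>h. (- (E ** fst (snd h) ** E) *v fst w) $ j)) (at p)"
      by (simp add: theta_def)
    then show ?thesis by (rule frechet_derivative_at[symmetric])
  qed
  have "(\<Sum>k\<in>UNIV. wedge 1 1 (omega j k) (theta k) p [v, w]) =
     ((E ** cartan p v) *v (E *v fst w) - (E ** cartan p w) *v (E *v fst v)) $ j"
    by (simp add: wedge_1_1[unfolded One_nat_def] omega_eq theta_def sum_subtractf E_def
        matrix_vector_mult_def[of "E ** _" for E])
  then have "torsion j p [v, w] = (- (E ** fst (snd v) ** E) *v fst w) $ j - (- (E ** fst (snd w) ** E) *v fst v) $ j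
     + ((E ** cartan p v) *v (E *v fst w) - (E ** cartan p w) *v (E *v fst v)) $ j"
    unfolding torsion_def ext_deriv_2 d by simp
  also have "\<dots> = (E *v (hor z (fst w) *v (E *v fst v) - hor z (fst v) *v (E *v fst w))) $ j"
    unfolding v
    by (simp add: matrix_mult_add matrix_vector_mul_assoc matrix_mul_assoc
        bounded_bilinear.minus_left[OF bounded_bilinear_matrix_vector_mult]
        bounded_bilinear.add_left[OF bounded_bilinear_matrix_vector_mult]
        bounded_bilinear.diff_left[OF bounded_bilinear_matrix_vector_mult]
        bounded_bilinear.diff_right[OF bounded_bilinear_matrix_vector_mult])
  finally show ?thesis .
qed

text \<open>For \<open>z = - \<Gamma> e\<close> the factors \<open>e\<close> and its inverse cancel
  in \<open>torsion_eq\<close>, leaving the antisymmetric part of \<Gamma> applied to the two base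
  vectors.\<close>

lemma torsion_free:
  fixes p :: "('m::finite mat, 'm) j1"
  assumes "invertible (frame_of p)"
    and z: "\<And>\<sigma>. snd (snd p) $ \<sigma> = - (\<Gamma> \<sigma> ** frame_of p)"
    and sym: "\<And>\<sigma> \<nu> \<rho>. \<Gamma> \<sigma> $ \<rho> $ \<nu> = \<Gamma> \<nu> $ \<rho> $ \<sigma>"
  shows "torsion j p [v, w] = 0"
proof -
  let ?e = "frame_of p" and ?E = "matrix_inv (frame_of p)"
  have hor: "hor (snd (snd p)) x *v (?E *v y) = - (\<Sum>\<sigma>\<in>UNIV. x $ \<sigma> *\<^sub>R (\<Gamma> \<sigma> *v y))" for x y
  proof -
    have "hor (snd (snd p)) x = - ((\<Sum>\<sigma>\<in>UNIV. x $ \<sigma> *\<^sub>R \<Gamma> \<sigma>) ** ?e)"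
      by (simp add: hor_def z sum_negf bounded_bilinear.sum_left[OF bounded_bilinear_matrix_mult]
          matrix_mult_scaleR)
    moreover have "((\<Sum>\<sigma>\<in>UNIV. x $ \<sigma> *\<^sub>R \<Gamma> \<sigma>) ** ?e) *v (?E *v y) = (\<Sum>\<sigma>\<in>UNIV. x $ \<sigma> *\<^sub>R \<Gamma> \<sigma>) *v y"
      by (simp add: matrix_vector_mul_assoc matrix_inv_right assms(1) flip: matrix_mul_assoc)
    ultimately show ?thesis
      by (simp add: bounded_bilinear.minus_left[OF bounded_bilinear_matrix_vector_mult]
          bounded_bilinear.sum_left[OF bounded_bilinear_matrix_vector_mult]
          bounded_bilinear.scaleR_left[OF bounded_bilinear_matrix_vector_mult])
  qed
  have "(\<Sum>\<sigma>\<in>UNIV. x $ \<sigma> *\<^sub>R (\<Gamma> \<sigma> *v y)) = (\<Sum>\<sigma>\<in>UNIV. y $ \<sigma> *\<^sub>R (\<Gamma> \<sigma> *v x))" for x y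
  proof -
    have "(\<Sum>\<sigma>\<in>UNIV. x $ \<sigma> *\<^sub>R (\<Gamma> \<sigma> *v y)) $ \<rho> = (\<Sum>\<sigma>\<in>UNIV. y $ \<sigma> *\<^sub>R (\<Gamma> \<sigma> *v x)) $ \<rho>" for \<rho>
      unfolding sum_component vector_scaleR_component
        matrix_vector_mult_def vec_lambda_beta real_scaleR_def sum_distrib_left
      by (subst sum.swap) (simp add: sym[of _ \<rho>] mult_ac)
    then show ?thesis by (simp add: vec_eq_iff)
  qed
  from this[of "fst w" "fst v"] show ?thesis
    unfolding torsion_eq[OF assms(1)] hor by simp
qed

lemma sum_swap3: "(\<Sum>k\<in>C. \<Sum>\<mu>\<in>D. \<Sum>\<nu>\<in>F. g k \<mu> \<nu>) = (\<Sum>\<mu>\<in>D. \<Sum>\<nu>\<in>F. \<Sum>k\<in>C. g k \<mu> \<nu>)"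
  by (subst sum.swap) (intro sum.cong refl sum.swap)

text \<open>\<open>ws\<close> stands for the images of the coordinate vectors under a lift with
  \<open>z = - \<Gamma> e\<close>: \<open>De\<close> is the derivative of its frame,
  \<open>Dz\<close> the product rule for \<open>- \<Gamma> e\<close>, and
  \<open>D\<Gamma> \<mu> \<nu>\<close> the \<mu>-derivative of \<open>\<Gamma> \<nu>\<close>. The
  statement is purely algebraic in these data.\<close>

lemma L_PG_eq:
  fixes p :: "('m::{finite,linorder} mat, 'm) j1"
  defines "e \<equiv> frame_of p"
  assumes e: "invertible e"
    and z: "\<And>\<sigma>. snd (snd p) $ \<sigma> = - (\<Gamma> \<sigma> ** e)"
    and ws: "length ws = CARD('m)" "\<And>a. a < CARD('m) \<Longrightarrow> ws ! a = (axis (idx a) 1, De (idx a), Dz (idx a))"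
    and Dz: "\<And>\<mu> \<nu>. Dz \<mu> $ \<nu> = - (D\<Gamma> \<mu> \<nu> ** e + \<Gamma> \<nu> ** De \<mu>)"
    and R: "\<And>\<mu> \<nu>. R \<mu> \<nu> = D\<Gamma> \<mu> \<nu> - D\<Gamma> \<nu> \<mu> + (\<Gamma> \<mu> ** \<Gamma> \<nu> - \<Gamma> \<nu> ** \<Gamma> \<mu>)"
  shows "L_PG p ws = (\<Sum>\<sigma>\<in>UNIV. \<Sum>\<nu>\<in>UNIV. frame_metric e $ \<sigma> $ \<nu> * (\<Sum>\<rho>\<in>UNIV. R \<rho> \<nu> $ \<rho> $ \<sigma>))
     * det (matrix_inv e)"
proof -
  define E where "E = matrix_inv e"
  have eE: "e ** E = mat 1" using e by (simp add: E_def matrix_inv_right)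
  have eE': "A ** e ** E = A" for A by (simp add: eE flip: matrix_mul_assoc)
  \<comment> \<open>The Cartan part of \<open>ws ! a\<close> is \<open>De + \<Gamma> e\<close>. Its
    terms with \<open>De\<close> cancel against those of \<open>Dz\<close>, so the derivative of the
    frame disappears and the curvature conjugated by \<open>e\<close> remains.\<close>
  have Om: "Omega k q p [ws ! a, ws ! b] = (E ** R (idx a) (idx b) ** e) $ k $ q"
    if "a < CARD('m)" "b < CARD('m)" for a b k q
    unfolding Omega_eq[OF e[unfolded e_def]] ws(2)[OF that(1)] ws(2)[OF that(2)] cartan_eq fst_conv snd_conv
      hor_axis z Dz e_def[symmetric] E_def[symmetric]
    by (simp add: R matrix_mult_add matrix_mult_diff matrix_mult_uminus matrix_mul_assoc eE')
  have anti: "(E ** R \<nu> \<mu> ** e) $ k $ q = - (E ** R \<mu> \<nu> ** e) $ k $ q" for \<mu> \<nu> k q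
  proof -
    have "R \<nu> \<mu> = - R \<mu> \<nu>" by (simp add: R)
    then show ?thesis by (simp add: matrix_mult_uminus)
  qed
  have "L_PG p ws = (\<Sum>i\<in>UNIV. \<Sum>q\<in>UNIV. \<Sum>k\<in>UNIV. eta $ i $ q *
      ((\<Sum>\<mu>\<in>UNIV. \<Sum>\<nu>\<in>UNIV. e $ \<mu> $ k * e $ \<nu> $ i * (E ** R \<mu> \<nu> ** e) $ k $ q) * det E))"
  proof -
    have "wedge (CARD('m) - 2) 2 (theta2 i k) (Omega k q) p ws =
        (\<Sum>\<mu>\<in>UNIV. \<Sum>\<nu>\<in>UNIV. e $ \<mu> $ k * e $ \<nu> $ i * (E ** R \<mu> \<nu> ** e) $ k $ q) * det E" for i k q
    proof -
      have "wedge (CARD('m) - 2) 2 (theta2 i k) (Omega k q) p ws =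
        (\<Sum>a<CARD('m). \<Sum>b<CARD('m). frame_of p $ idx a $ k * frame_of p $ idx b $ i *
            (E ** R (idx a) (idx b) ** e) $ k $ q) * det (matrix_inv (frame_of p))"
      proof (rule wedge_theta2)
        show "fst (ws ! a) = axis (idx a) 1" if "a < CARD('m)" for a by (simp add: ws(2) that)
      qed (rule ws Om anti; assumption)+
      then show ?thesis
        by (simp add: E_def e_def flip: sum_idx)
    qed
    then show ?thesis by (simp add: L_PG_def matrix_inv_eta)
  qed
  also have "\<dots> = (\<Sum>i\<in>UNIV. \<Sum>q\<in>UNIV. \<Sum>k\<in>UNIV. \<Sum>\<mu>\<in>UNIV. \<Sum>\<nu>\<in>UNIV.
      e $ \<nu> $ i * eta $ i $ q * (E ** R \<mu> \<nu> ** e) $ k $ q * e $ \<mu> $ k) * det E"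
    by (simp add: sum_distrib_left sum_distrib_right mult_ac)
  also have "(\<Sum>i\<in>UNIV. \<Sum>q\<in>UNIV. \<Sum>k\<in>UNIV. \<Sum>\<mu>\<in>UNIV. \<Sum>\<nu>\<in>UNIV.
      e $ \<nu> $ i * eta $ i $ q * (E ** R \<mu> \<nu> ** e) $ k $ q * e $ \<mu> $ k) =
    (\<Sum>\<mu>\<in>UNIV. \<Sum>\<nu>\<in>UNIV. \<Sum>i\<in>UNIV. \<Sum>q\<in>UNIV. \<Sum>k\<in>UNIV.
      e $ \<nu> $ i * eta $ i $ q * (E ** R \<mu> \<nu> ** e) $ k $ q * e $ \<mu> $ k)"
    (is "(\<Sum>i\<in>UNIV. \<Sum>q\<in>UNIV. \<Sum>k\<in>UNIV. \<Sum>\<mu>\<in>UNIV. \<Sum>\<nu>\<in>UNIV. ?f i q k \<mu> \<nu>) = _")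
  proof -
    have "(\<Sum>i\<in>UNIV. \<Sum>q\<in>UNIV. \<Sum>k\<in>UNIV. \<Sum>\<mu>\<in>UNIV. \<Sum>\<nu>\<in>UNIV. ?f i q k \<mu> \<nu>) =
        (\<Sum>i\<in>UNIV. \<Sum>q\<in>UNIV. \<Sum>\<mu>\<in>UNIV. \<Sum>\<nu>\<in>UNIV. \<Sum>k\<in>UNIV. ?f i q k \<mu> \<nu>)"
      by (intro sum.cong refl sum_swap3)
    also have "\<dots> = (\<Sum>i\<in>UNIV. \<Sum>\<mu>\<in>UNIV. \<Sum>\<nu>\<in>UNIV. \<Sum>q\<in>UNIV. \<Sum>k\<in>UNIV. ?f i q k \<mu> \<nu>)"
      by (intro sum.cong refl sum_swap3)
    also have "\<dots> = (\<Sum>\<mu>\<in>UNIV. \<Sum>\<nu>\<in>UNIV. \<Sum>i\<in>UNIV. \<Sum>q\<in>UNIV. \<Sum>k\<in>UNIV. ?f i q k \<mu> \<nu>)"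
      by (rule sum_swap3)
    finally show ?thesis .
  qed
  also have "\<dots> = (\<Sum>\<mu>\<in>UNIV. \<Sum>\<nu>\<in>UNIV. \<Sum>\<sigma>\<in>UNIV. frame_metric e $ \<sigma> $ \<nu> * R \<mu> \<nu> $ \<mu> $ \<sigma>)"
  proof (rule sum.cong[OF refl], rule sum.cong[OF refl])
    fix \<mu> \<nu>
    \<comment> \<open>Read as a matrix product, the sum over frame indices has \<open>e ** E\<close>
      collapse to the identity, while the other factors \<open>e\<close> and \<open>eta\<close>
      combine to \<open>frame_metric e\<close>.\<close>
    have "(\<Sum>i\<in>UNIV. \<Sum>q\<in>UNIV. \<Sum>k\<in>UNIV. e $ \<nu> $ i * eta $ i $ q * M $ k $ q * e $ \<mu> $ k) =
        (e ** (eta ** (transpose M ** transpose e))) $ \<nu> $ \<mu>" for M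
      by (simp add: matrix_matrix_mult_def transpose_def sum_distrib_left mult.assoc)
    then have "(\<Sum>i\<in>UNIV. \<Sum>q\<in>UNIV. \<Sum>k\<in>UNIV. e $ \<nu> $ i * eta $ i $ q * (E ** R \<mu> \<nu> ** e) $ k $ q * e $ \<mu> $ k) =
        (e ** (eta ** (transpose (E ** R \<mu> \<nu> ** e) ** transpose e))) $ \<nu> $ \<mu>" .
    also have "e ** (eta ** (transpose (E ** R \<mu> \<nu> ** e) ** transpose e)) =
        frame_metric e ** transpose (R \<mu> \<nu>)"
      unfolding frame_metric_eq matrix_transpose_mul[symmetric] matrix_mul_assoc eE
      by (simp add: matrix_transpose_mul matrix_mul_assoc)
    also have "\<dots> $ \<nu> $ \<mu> = (\<Sum>\<sigma>\<in>UNIV. frame_metric e $ \<sigma> $ \<nu> * R \<mu> \<nu> $ \<mu> $ \<sigma>)"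
      by (subst transpose_frame_metric[symmetric]) (simp add: matrix_matrix_mult_def transpose_def)
    finally show "(\<Sum>i\<in>UNIV. \<Sum>q\<in>UNIV. \<Sum>k\<in>UNIV. e $ \<nu> $ i * eta $ i $ q * (E ** R \<mu> \<nu> ** e) $ k $ q * e $ \<mu> $ k) = \<dots>" .
  qed
  also have "\<dots> = (\<Sum>\<sigma>\<in>UNIV. \<Sum>\<nu>\<in>UNIV. frame_metric e $ \<sigma> $ \<nu> * (\<Sum>\<rho>\<in>UNIV. R \<rho> \<nu> $ \<rho> $ \<sigma>))"
    (is "(\<Sum>\<mu>\<in>UNIV. \<Sum>\<nu>\<in>UNIV. \<Sum>\<sigma>\<in>UNIV. ?f \<mu> \<nu> \<sigma>) = _")
  proof -
    have "(\<Sum>\<mu>\<in>UNIV. \<Sum>\<nu>\<in>UNIV. \<Sum>\<sigma>\<in>UNIV. ?f \<mu> \<nu> \<sigma>) = (\<Sum>\<nu>\<in>UNIV. \<Sum>\<sigma>\<in>UNIV. \<Sum>\<mu>\<in>UNIV. ?f \<mu> \<nu> \<sigma>)"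
      by (rule sum_swap3)
    also have "\<dots> = (\<Sum>\<sigma>\<in>UNIV. \<Sum>\<nu>\<in>UNIV. \<Sum>\<mu>\<in>UNIV. ?f \<mu> \<nu> \<sigma>)"
      by (rule sum.swap)
    finally show ?thesis by (simp add: sum_distrib_left)
  qed
  finally show ?thesis by (simp add: E_def)
qed

section \<open>Local orthonormal frames\<close>

lemma Ck_on_const: "Ck_on n S (\<lambda>_. c)"
proof (induction n arbitrary: c)
  case (Suc n)
  then show ?case by simp
qed simp

lemma jet1_rep_has_derivative:
  "(jet1_rep (x, f, z) has_derivative (\<lambda>k. \<Sum>\<sigma>\<in>UNIV. k $ \<sigma> *\<^sub>R z $ \<sigma>)) (at y)"
proof -
  have lin: "((\<lambda>y. (y - x) $ \<sigma>) has_derivative (\<lambda>k. k $ \<sigma>)) (at y)" for \<sigma>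
    using has_derivative_vec_nth[OF has_derivative_diff[OF has_derivative_ident has_derivative_const]]
    by fastforce
  have eq: "jet1_rep (x, f, z) = (\<lambda>y. f + (\<Sum>\<sigma>\<in>UNIV. (y - x) $ \<sigma> *\<^sub>R z $ \<sigma>))"
    by (simp add: jet1_rep_def fun_eq_iff)
  show ?thesis
    unfolding eq by (rule derivative_eq_intros refl lin)+ (simp add: fun_eq_iff)
qed

lemma smooth_on_jet1_rep: "smooth_on S (jet1_rep j)"
proof -
  obtain x f z where j: "j = (x, f, z)" by (cases j) auto
  have "Ck_on n S (jet1_rep j)" for n
  proof (cases n)
    case 0
    show ?thesis
      unfolding 0 j Ck_on.simps
      by (intro continuous_at_imp_continuous_on ballI has_derivative_continuous[OF jet1_rep_has_derivative])
  next
    case (Suc k)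
    have "frechet_derivative (jet1_rep j) (at y) = (\<lambda>k. \<Sum>\<sigma>\<in>UNIV. k $ \<sigma> *\<^sub>R z $ \<sigma>)" for y
      unfolding j by (rule frechet_derivative_at[symmetric, OF jet1_rep_has_derivative])
    then show ?thesis
      by (simp add: Suc j Ck_on_const differentiableI[OF jet1_rep_has_derivative])
  qed
  then show ?thesis by (simp add: smooth_on_def)
qed

lemma jet1_jet1_rep: "jet1 (jet1_rep (x, f, z)) x = (x, f, z)"
proof -
  have "pd \<sigma> (jet1_rep (x, f, z)) x = z $ \<sigma>" for \<sigma>
    unfolding has_derivative_pd[OF jet1_rep_has_derivative]
    by (simp add: axis_def if_distrib[of "\<lambda>c. c *\<^sub>R _"] cong: if_cong)
  then show ?thesis by (simp add: jet1_def) (simp add: jet1_rep_def)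
qed

text \<open>Invertibility is an open condition, so the affine representative stays in
  \<open>frames\<close> near \<open>x\<close> for every \<open>z\<close>. Hence a jet may be
  prescribed pointwise, without a section realising it at neighbouring points.\<close>

lemma jet1_space_frames:
  fixes x :: "real^'m::finite" and f :: "'m mat"
  assumes "open D" "x \<in> D" "invertible f"
  shows "(x, f, z) \<in> jet1_space D frames"
proof -
  let ?s = "jet1_rep (x, f, z)"
  have "continuous_on UNIV ?s"
    using smooth_on_jet1_rep[of UNIV "(x, f, z)", unfolded smooth_on_def] by (metis Ck_on.simps(1))
  then have "open (?s -` {A. invertible A})"
    using open_invertible by (rule open_vimage[rotated])
  then have "open (D \<inter> ?s -` {A. invertible A})" using assms(1) by blast
  moreover have "x \<in> D \<inter> ?s -` {A. invertible A}"
    using assms by (simp add: jet1_rep_def)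
  ultimately show ?thesis
    unfolding jet1_space_def mem_Collect_eq
    by (intro exI[of _ ?s] exI[of _ x] conjI exI[of _ "D \<inter> ?s -` {A. invertible A}"])
      (auto simp: jet1_jet1_rep frames_def smooth_on_jet1_rep)
qed

text \<open>The product rule makes the projection explicitly polynomial; its differentiability is
  needed for the chain rule along the lift.\<close>

lemma jet1_frame_metric_eq:
  "jet1_frame_metric (x, e, z) =
     (x, frame_metric e, \<chi> \<sigma>. z $ \<sigma> ** eta ** transpose e + e ** eta ** transpose (z $ \<sigma>))"
proof -
  let ?s = "jet1_rep (x, e, z)"
  let ?D = "\<lambda>k. \<Sum>\<sigma>\<in>UNIV. k $ \<sigma> *\<^sub>R z $ \<sigma>"
  have "(frame_metric \<circ> ?s has_derivative
      (\<lambda>k. (?s x ** eta) ** transpose (?D k) + (?s x ** 0 + ?D k ** eta) ** transpose (?s x))) (at x)"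
    unfolding o_def frame_metric_eq
    by (intro has_derivative_matrix_mult has_derivative_transpose has_derivative_const jet1_rep_has_derivative)
  from has_derivative_pd[OF this]
  have "pd \<sigma> (frame_metric \<circ> ?s) x = z $ \<sigma> ** eta ** transpose e + e ** eta ** transpose (z $ \<sigma>)" for \<sigma>
    by (simp add: axis_def if_distrib[of "\<lambda>c. c *\<^sub>R _"] jet1_rep_def add.commute
        bounded_bilinear.zero_right[OF bounded_bilinear_matrix_mult] cong: if_cong)
  moreover have "?s x = e" by (simp add: jet1_rep_def)
  ultimately show ?thesis by (simp add: jet1_frame_metric_def jet1_def)
qed

lemma differentiable_transpose:
  fixes f :: "'a::real_normed_vector \<Rightarrow> real^'n^'m"
  assumes "f differentiable (at x within S)"
  shows "(\<lambda>x. transpose (f x)) differentiable (at x within S)"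
  using assms unfolding differentiable_def by (blast intro: has_derivative_transpose)

lemma differentiable_Pair:
  assumes "f differentiable (at x within S)" "g differentiable (at x within S)"
  shows "(\<lambda>x. (f x, g x)) differentiable (at x within S)"
  using assms unfolding differentiable_def by (blast intro: has_derivative_Pair)

lemma differentiable_jet1_frame_metric: "jet1_frame_metric differentiable (at p)"
proof -
  have eq: "jet1_frame_metric = (\<lambda>p. (fst p, frame_of p ** eta ** transpose (frame_of p),
      \<chi> \<sigma>. snd (snd p) $ \<sigma> ** eta ** transpose (frame_of p) + frame_of p ** eta ** transpose (snd (snd p) $ \<sigma>)))"
    by (auto simp: fun_eq_iff jet1_frame_metric_eq frame_metric_eq)
  have 1: "fst differentiable at p" "frame_of differentiable at p" "(\<lambda>p. snd (snd p)) differentiable at p"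
    by (rule differentiableI[OF has_derivative_fst[OF has_derivative_ident]]
        differentiableI[OF frame_of_has_derivative]
        differentiableI[OF has_derivative_snd[OF has_derivative_snd[OF has_derivative_ident]]])+
  have 2: "(\<lambda>p. snd (snd p) $ \<sigma>) differentiable at p" for \<sigma>
    by (rule differentiable_vec_nth[OF 1(3)])
  show ?thesis
    unfolding eq
    by (rule differentiable_Pair[OF 1(1) differentiable_Pair[OF _ differentiable_vec_lambda]])
      (intro differentiable_add differentiable_matrix_mult differentiable_transpose differentiable_const 1 2)+
qed

text \<open>At the identity, squaring has derivative \<open>H \<mapsto> 2 H\<close>, so the inverse
  function theorem applies with inverse derivative one half. Of the two identities for
  \<open>Q\<close>, \<open>Q S ** Q S = S\<close> gives a root and \<open>Q (P ** P) = P\<close> its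
  local uniqueness.\<close>

lemma matrix_sqrt_near_identity:
  obtains U V and Q :: "real^'n^'n \<Rightarrow> real^'n^'n"
  where "open U" "open V" "mat 1 \<in> U" "mat 1 \<in> V" "Q differentiable (at (mat 1))"
    "\<And>P. P \<in> U \<Longrightarrow> Q (P ** P) = P" "\<And>S. S \<in> V \<Longrightarrow> Q S ** Q S = S"
proof -
  define f' :: "real^'n^'n \<Rightarrow> (real^'n^'n) \<Rightarrow>\<^sub>L (real^'n^'n)"
    where "f' P = Blinfun (\<lambda>H. P ** H + H ** P)" for P
  have f': "blinfun_apply (f' P) H = P ** H + H ** P" for P H
    unfolding f'_def
    by (rule bounded_linear_Blinfun_apply[THEN fun_cong])
      (intro bounded_linear_add bounded_bilinear.bounded_linear_right[OF bounded_bilinear_matrix_mult]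
        bounded_bilinear.bounded_linear_left[OF bounded_bilinear_matrix_mult])
  have der: "((\<lambda>P. P ** P) has_derivative blinfun_apply (f' P)) (at P)" for P
  proof -
    have "blinfun_apply (f' P) = (\<lambda>H. P ** H + H ** P)" by (simp add: f' fun_eq_iff)
    then show ?thesis
      using has_derivative_matrix_mult[OF has_derivative_ident has_derivative_ident] by simp
  qed
  have cont: "continuous_on UNIV f'"
    by (rule continuous_on_blinfun_componentwise)
      (auto simp: f' intro!: continuous_on_add bounded_bilinear.continuous_on[OF bounded_bilinear_matrix_mult] continuous_on_id continuous_on_const)
  have inv: "((1/2) *\<^sub>R id_blinfun) o\<^sub>L f' (mat 1) = id_blinfun"
    by (rule blinfun_eqI)
      (simp only: blinfun_apply_blinfun_compose f' matrix_mul_lid matrix_mul_rid blinfun.scaleR_left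
        blinfun_apply_id_blinfun scaleR_half_double)
  obtain U V g g' where "open U" "U \<subseteq> UNIV" "mat 1 \<in> U" "open V" "mat 1 ** mat 1 \<in> V"
    and hom: "homeomorphism U V (\<lambda>P::real^'n^'n. P ** P) g"
    and g: "\<And>y. y \<in> V \<Longrightarrow> (g has_derivative (g' y)) (at y)"
    by (rule inverse_function_theorem[OF open_UNIV der cont UNIV_I inv]) (rule that)
  then have mem: "mat 1 \<in> V" by simp
  show thesis
  proof (rule that[OF \<open>open U\<close> \<open>open V\<close> \<open>mat 1 \<in> U\<close> mem differentiableI[OF g[OF mem]]])
    show "g (P ** P) = P" if "P \<in> U" for P using hom that by (simp add: homeomorphism_def)
    show "g S ** g S = S" if "S \<in> V" for S using hom that by (simp add: homeomorphism_def)
  qed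
qed

text \<open>The local frame is \<open>e = (g g\<^sub>0\<^sup>-\<^sup>1)\<^sup>1\<^sup>/\<^sup>2 e\<^sub>0\<close>; the square root is self-adjoint for \<open>g\<^sub>0\<close>
  by its local uniqueness.\<close>

lemma ex_local_frame:
  fixes g :: "real^'m::{finite,linorder} \<Rightarrow> 'm mat"
  assumes g: "g differentiable at x" and sym: "\<forall>\<^sub>F y in nhds x. transpose (g y) = g y \<and> invertible (g y)"
    and e0: "g x = frame_metric e0" "invertible e0"
  obtains e where "e x = e0" "e differentiable at x"
    "\<forall>\<^sub>F y in nhds x. invertible (e y) \<and> frame_metric (e y) = g y"
proof -
  obtain U V and Q :: "'m mat \<Rightarrow> 'm mat" where Q: "open U" "open V" "mat 1 \<in> U" "mat 1 \<in> V"
    "Q differentiable (at (mat 1))" "\<And>P. P \<in> U \<Longrightarrow> Q (P ** P) = P" "\<And>S. S \<in> V \<Longrightarrow> Q S ** Q S = S"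
    by (rule matrix_sqrt_near_identity) (rule that)
  define g0 where "g0 = g x"
  have g0: "invertible g0" "transpose g0 = g0"
    unfolding g0_def e0 by (simp_all add: invertible_frame_metric e0 transpose_frame_metric)
  have g0_inv: "A ** g0 ** matrix_inv g0 = A" "A ** matrix_inv g0 ** g0 = A" for A
    by (simp_all add: matrix_inv_right matrix_inv_left g0 flip: matrix_mul_assoc)
  define S where "S y = g y ** matrix_inv g0" for y
  have S_x: "S x = mat 1" by (simp add: S_def g0_def[symmetric] matrix_inv_right g0)
  have dS: "S differentiable at x"
    unfolding S_def[abs_def] by (intro differentiable_matrix_mult g differentiable_const)
  have Q1: "Q (mat 1) = mat 1" using Q(6)[OF Q(3)] by simp
  obtain S' Q' where "(S has_derivative S') (at x)" "(Q has_derivative Q') (at (S x))"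
    using dS Q(5) unfolding S_x differentiable_def by blast
  from has_derivative_compose[OF this] have dQS: "(\<lambda>y. Q (S y)) differentiable at x"
    by (rule differentiableI)
  define e where "e y = Q (S y) ** e0" for y
  \<comment> \<open>\<open>P y\<close> is the adjoint of \<open>Q (S y)\<close> with respect to
    \<open>g0\<close>. It squares to \<open>S y\<close> as well, because \<open>S y\<close> is
    self-adjoint, and it is close to the identity for \<open>y\<close> near \<open>x\<close>;
    uniqueness of the root then forces \<open>Q (S y) = P y\<close>.\<close>
  define P where "P y = g0 ** transpose (Q (S y)) ** matrix_inv g0" for y
  have "P differentiable at x"
    unfolding P_def[abs_def] by (intro differentiable_matrix_mult differentiable_transpose dQS differentiable_const)
  then have "isCont P x" by (rule differentiable_imp_continuous_within)
  then have P: "filterlim P (nhds (P x)) (nhds x)"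
    by (simp add: isCont_def tendsto_at_iff_tendsto_nhds)
  have P_x: "P x = mat 1" by (simp add: P_def S_x Q1 transpose_mat matrix_inv_right g0)
  have evU: "\<forall>\<^sub>F y in nhds x. P y \<in> U"
    using P eventually_nhds_in_open[OF Q(1,3)] unfolding P_x filterlim_iff by blast
  have "isCont S x" using dS by (rule differentiable_imp_continuous_within)
  then have "filterlim S (nhds (S x)) (nhds x)"
    by (simp add: isCont_def tendsto_at_iff_tendsto_nhds)
  then have evV: "\<forall>\<^sub>F y in nhds x. S y \<in> V"
    using eventually_nhds_in_open[OF Q(2,4)] unfolding S_x filterlim_iff by blast
  show thesis
  proof (rule that)
    show "e x = e0" by (simp add: e_def S_x Q1)
    show "e differentiable at x"
      unfolding e_def[abs_def] by (intro differentiable_matrix_mult dQS differentiable_const)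
    show "\<forall>\<^sub>F y in nhds x. invertible (e y) \<and> frame_metric (e y) = g y"
      using sym evU evV
    proof eventually_elim
      case (elim y)
      have "P y ** P y = g0 ** (transpose (Q (S y)) ** transpose (Q (S y))) ** matrix_inv g0"
        unfolding P_def by (simp add: matrix_mul_assoc g0_inv)
      also have "transpose (Q (S y)) ** transpose (Q (S y)) = transpose (S y)"
        by (simp add: Q(7) elim(3) flip: matrix_transpose_mul)
      also have "\<dots> = matrix_inv g0 ** g y"
        using elim(1) by (simp add: S_def matrix_transpose_mul transpose_matrix_inv g0)
      also have "g0 ** (matrix_inv g0 ** g y) ** matrix_inv g0 = S y"
        by (simp add: matrix_mul_assoc matrix_inv_right g0 S_def)
      finally have "Q (S y) = P y" using Q(6)[OF elim(2)] by simp
      \<comment> \<open>Self-adjointness moves the transposed root across \<open>g0\<close>, so that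
        the metric of the new frame becomes \<open>S y ** g0\<close>, which is
        \<open>g y\<close>.\<close>
      then have PQ: "Q (S y) ** g0 = g0 ** transpose (Q (S y))"
        by (metis P_def g0_inv(2))
      have "frame_metric (e y) = Q (S y) ** (e0 ** eta ** transpose e0) ** transpose (Q (S y))"
        by (simp add: frame_metric_eq e_def matrix_transpose_mul matrix_mul_assoc)
      also have "e0 ** eta ** transpose e0 = g0" by (simp add: g0_def e0 frame_metric_eq)
      also have "Q (S y) ** g0 ** transpose (Q (S y)) = Q (S y) ** Q (S y) ** g0"
        by (metis PQ matrix_mul_assoc)
      also have "\<dots> = g y" unfolding Q(7)[OF elim(3)] by (simp add: S_def g0_inv)
      finally have fm: "frame_metric (e y) = g y" .
      have "det (frame_metric (e y)) \<noteq> 0"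
        using elim(1) by (simp add: fm flip: invertible_det_nz)
      then have "invertible (e y)" by (simp add: frame_metric_eq det_mul invertible_det_nz)
      with fm show ?case by simp
    qed
  qed
qed

section \<open>The pulled back Lagrangians\<close>

definition coordinate_vectors :: "(real^'m::{finite,linorder}) list" where
  "coordinate_vectors = map (\<lambda>\<mu>. axis \<mu> 1) (sorted_list_of_set UNIV)"

lemma length_coordinate_vectors:
  "length (coordinate_vectors :: (real^'m::{finite,linorder}) list) = CARD('m)"
  by (simp add: coordinate_vectors_def)

lemma nth_coordinate_vectors:
  "a < CARD('m) \<Longrightarrow> (coordinate_vectors :: (real^'m::{finite,linorder}) list) ! a = axis (idx a) 1"
  by (simp add: coordinate_vectors_def idx_def)

lemma transpose_pd:
  fixes g :: "real^'m \<Rightarrow> real^'n^'n"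
  assumes "\<forall>\<^sub>F y in nhds x. transpose (g y) = g y" "g differentiable at x"
  shows "transpose (pd \<sigma> g x) = pd \<sigma> g x"
proof -
  obtain D where D: "(g has_derivative D) (at x)" using assms(2) by (auto simp: differentiable_def)
  have "pd \<sigma> (\<lambda>y. transpose (g y)) x = transpose (pd \<sigma> g x)"
    by (simp add: has_derivative_pd[OF D] has_derivative_pd[OF has_derivative_transpose[OF D]])
  from this pd_cong[OF assms(1), of \<sigma>] show ?thesis by (rule trans[OF sym])
qed

lemma
  fixes g :: "real^'m::{finite,linorder} \<Rightarrow> 'm mat"
  assumes g: "twice_differentiable g x" and sym: "\<forall>\<^sub>F y in nhds x. transpose (g y) = g y \<and> invertible (g y)"
  shows connection_symmetric: "connection g \<mu> x $ \<rho> $ \<nu> = connection g \<nu> x $ \<rho> $ \<mu>"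
    and connection_metric: "connection g \<mu> x ** g x + g x ** transpose (connection g \<mu> x) = - pd \<mu> g x"
proof -
  have pd: "transpose (pd \<sigma> g x) = pd \<sigma> g x" for \<sigma>
    by (rule transpose_pd[OF _ twice_differentiableD(1)[OF g]])
      (rule eventually_mono[OF sym], blast)
  have gx: "transpose (g x) = g x" "invertible (g x)"
    using eventually_nhds_x_imp_x[OF sym] by auto
  show "connection g \<mu> x $ \<rho> $ \<nu> = connection g \<nu> x $ \<rho> $ \<mu>"
    unfolding connection_def by (rule levi_civita_symmetric[OF gx]) (simp add: pd)
  show "connection g \<mu> x ** g x + g x ** transpose (connection g \<mu> x) = - pd \<mu> g x"
    unfolding connection_def
    using levi_civita_metric[of "g x" "\<chi> \<sigma>. pd \<sigma> g x" \<mu>] pd gx by simp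
qed

text \<open>The last entry is the derivative that \<open>e\<close> would have at \<open>y\<close> if
  it were parallel for the Levi-Civita connection, not its actual derivative.\<close>

definition torsion_free_jet :: "(real^'m::finite \<Rightarrow> 'm mat) \<Rightarrow> (real^'m \<Rightarrow> 'm mat) \<Rightarrow> real^'m \<Rightarrow> ('m mat, 'm) j1" where
  "torsion_free_jet g e y = (y, e y, \<chi> \<nu>. - (connection g \<nu> y ** e y))"

lemma torsion_free_jet_in_T0:
  fixes g :: "real^'m::{finite,linorder} \<Rightarrow> 'm mat"
  assumes g: "twice_differentiable g y" and sym: "\<forall>\<^sub>F y in nhds y. transpose (g y) = g y \<and> invertible (g y)"
    and e: "invertible (e y)" and c: "open (chart_image c)" "y \<in> chart_image c"
  shows "torsion_free_jet g e y \<in> T0 c"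
  unfolding T0_def J1_frames_def
proof (intro CollectI conjI allI)
  show "torsion_free_jet g e y \<in> jet1_space (chart_image c) frames"
    unfolding torsion_free_jet_def by (rule jet1_space_frames[OF c e])
  show "torsion j (torsion_free_jet g e y) [v, w] = 0" for j v w
    by (rule torsion_free[where \<Gamma> = "\<lambda>\<sigma>. connection g \<sigma> y"])
      (use connection_symmetric[OF g sym] in \<open>simp_all add: torsion_free_jet_def e\<close>)
qed

lemma jet1_frame_metric_torsion_free_jet:
  fixes g :: "real^'m::{finite,linorder} \<Rightarrow> 'm mat"
  assumes g: "twice_differentiable g y" and sym: "\<forall>\<^sub>F y in nhds y. transpose (g y) = g y \<and> invertible (g y)"
    and e: "frame_metric (e y) = g y"
  shows "jet1_frame_metric (torsion_free_jet g e y) = jet1 g y"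
proof -
  have "- (connection g \<sigma> y ** e y) ** eta ** transpose (e y) + e y ** eta ** transpose (- (connection g \<sigma> y ** e y))
      = pd \<sigma> g y" for \<sigma>
  proof -
    have "transpose (- (connection g \<sigma> y ** e y)) = - (transpose (e y) ** transpose (connection g \<sigma> y))"
      by (simp add: linear_neg[OF bounded_linear.linear[OF bounded_linear_transpose]] matrix_transpose_mul)
    then have "- (connection g \<sigma> y ** e y) ** eta ** transpose (e y) + e y ** eta ** transpose (- (connection g \<sigma> y ** e y))
      = - (connection g \<sigma> y ** frame_metric (e y) + frame_metric (e y) ** transpose (connection g \<sigma> y))"
      by (simp add: frame_metric_eq matrix_mult_uminus matrix_mul_assoc)
    also have "\<dots> = pd \<sigma> g y" unfolding e connection_metric[OF g sym] by simp
    finally show ?thesis .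
  qed
  then show ?thesis by (simp add: torsion_free_jet_def jet1_frame_metric_eq jet1_def e)
qed

lemma torsion_free_jet_has_derivative:
  assumes g: "twice_differentiable g x" "invertible (g x)" and e: "(e has_derivative De) (at x)"
  shows "(torsion_free_jet g e has_derivative (\<lambda>h. (h, De h, \<chi> \<nu>. - (frechet_derivative (connection g \<nu>) (at x) h ** e x
     + connection g \<nu> x ** De h)))) (at x)"
proof -
  have "(connection g \<nu> has_derivative frechet_derivative (connection g \<nu>) (at x)) (at x)" for \<nu>
    using connection_differentiable[OF g] by (simp add: frechet_derivative_works)
  from has_derivative_minus[OF has_derivative_matrix_mult[OF this e]]
  have "((\<lambda>y. - (connection g \<nu> y ** e y)) has_derivative (\<lambda>h. - (frechet_derivative (connection g \<nu>) (at x) h ** e x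
     + connection g \<nu> x ** De h))) (at x)" for \<nu>
    by (simp add: add.commute)
  from has_derivative_Pair[OF has_derivative_ident has_derivative_Pair[OF e has_derivative_vec_lambda[OF this]]]
  show ?thesis unfolding torsion_free_jet_def[abs_def] .
qed

text \<open>The images of straight lines through \<open>x\<close> are the required curves. The
  identity characterising \<open>L_EH1\<close> is available only on vectors tangent to
  \<open>T0\<close>, so the images of the coordinate vectors have to be recognised as such.\<close>

lemma tangent_vectors_image:
  fixes F :: "'d::euclidean_space \<Rightarrow> 'e::euclidean_space"
  assumes F: "(F has_derivative D) (at x)" and S: "\<forall>\<^sub>F y in nhds x. F y \<in> S"
  shows "D v \<in> tangent_vectors S (F x)"
  unfolding tangent_vectors_def
proof (intro CollectI exI conjI)
  let ?\<gamma> = "\<lambda>t. F (x + t *\<^sub>R v)"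
  show "?\<gamma> 0 = F x" by simp
  have lin: "((\<lambda>t. x + t *\<^sub>R v) has_derivative (\<lambda>t. t *\<^sub>R v)) (at 0)"
    by (auto intro!: derivative_eq_intros)
  then have "isCont (\<lambda>t. x + t *\<^sub>R v) 0" by (rule has_derivative_continuous)
  then have "filterlim (\<lambda>t. x + t *\<^sub>R v) (nhds x) (at 0)" by (simp add: isCont_def)
  then show "\<forall>\<^sub>F t in at 0. ?\<gamma> t \<in> S" using S unfolding filterlim_iff by blast
  have "(F has_derivative D) (at (x + 0 *\<^sub>R v))" using F by simp
  from has_derivative_compose[OF lin this]
  have "(?\<gamma> has_derivative (\<lambda>t. D (t *\<^sub>R v))) (at 0)" .
  moreover have "D (t *\<^sub>R v) = t *\<^sub>R D v" for t
    using has_derivative_linear[OF F] by (rule linear_cmul)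
  ultimately show "(?\<gamma> has_vector_derivative D v) (at 0)"
    by (simp add: has_vector_derivative_def)
qed

lemma pullback_L_EH:
  fixes g :: "real^'m::{finite,linorder} \<Rightarrow> 'm mat"
  assumes D: "open D" "x \<in> D" and g: "smooth_on D g" "invertible (g x)"
  shows "pullback (jet2 g) L_EH x coordinate_vectors = scalar_curvature g x * sqrt \<bar>det (matrix_inv (g x))\<bar>"
proof -
  have twice: "twice_differentiable g x" by (rule smooth_on_twice_differentiable[OF g(1) D])
  have "((\<lambda>y. (g y, \<chi> \<sigma>. pd \<sigma> g y, \<chi> \<sigma> \<nu>. pd \<sigma> (pd \<nu> g) y)) differentiable at x)"
    by (intro differentiable_Pair differentiable_vec_lambda smooth_on_differentiable[OF _ D(2)]
        smooth_on_pd g)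
  then obtain D' where "((\<lambda>y. (g y, \<chi> \<sigma>. pd \<sigma> g y, \<chi> \<sigma> \<nu>. pd \<sigma> (pd \<nu> g) y)) has_derivative D') (at x)"
    by (auto simp: differentiable_def)
  from has_derivative_Pair[OF has_derivative_ident this]
  have "(jet2 g has_derivative (\<lambda>h. (h, D' h))) (at x)"
    unfolding jet2_def[abs_def] .
  then have "frechet_derivative (jet2 g) (at x) = (\<lambda>h. (h, D' h))"
    by (rule frechet_derivative_at[symmetric])
  \<comment> \<open>Jets of sections lie over the identity of the base, so the images of the
    coordinate vectors have unit coordinate volume.\<close>
  then have "volume_form (jet2 g x) (map (frechet_derivative (jet2 g) (at x)) coordinate_vectors) = 1"
    by (intro volume_form_basis) (simp_all add: length_coordinate_vectors nth_coordinate_vectors)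
  moreover have "scalar_curvature (jet2_rep (jet2 g x)) x = scalar_curvature g x"
    by (rule scalar_curvature_cong[OF twice twice_differentiable_jet2_rep[OF twice] g(2)
          jet2_rep_at[OF twice] pd_jet2_rep[OF twice] pd_pd_jet2_rep[OF twice]])
  moreover have "fst (jet2 g x) = x" "fst (snd (jet2 g x)) = g x" by (simp_all add: jet2_def)
  ultimately show ?thesis by (simp add: pullback_def L_EH_def)
qed

lemma pullback_L_EH1:
  fixes g :: "real^'m::{finite,linorder} \<Rightarrow> 'm mat" and c :: "('a, 'm) chart"
  assumes D: "open (chart_image c)" "x \<in> chart_image c"
    and g: "smooth_on (chart_image c) g" "g ` chart_image c \<subseteq> metrics"
    and L: "\<And>p vs. p \<in> T0 c \<Longrightarrow> length vs = CARD('m) \<Longrightarrow> set vs \<subseteq> tangent_vectors (T0 c) p \<Longrightarrow>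
        pullback jet1_frame_metric L p vs = sgn (det (frame_of p)) * L_PG p vs"
  shows "pullback (jet1 g) L x coordinate_vectors = scalar_curvature g x * sqrt \<bar>det (matrix_inv (g x))\<bar>"
proof -
  have twice: "twice_differentiable g y" if "y \<in> chart_image c" for y
    by (rule smooth_on_twice_differentiable[OF g(1) D(1) that])
  have metric: "transpose (g y) = g y \<and> invertible (g y)" if "y \<in> chart_image c" for y
    using g(2) that by (auto simp: metrics_def frames_def transpose_frame_metric invertible_frame_metric)
  have sym: "\<forall>\<^sub>F y in nhds y. transpose (g y) = g y \<and> invertible (g y)" if "y \<in> chart_image c" for y
    using eventually_nhds_in_open[OF D(1) that] by (rule eventually_mono) (rule metric)
  obtain e0 where e0: "g x = frame_metric e0" "invertible e0"
    using g(2) D(2) by (auto simp: metrics_def frames_def)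
  obtain e where e: "e x = e0" "e differentiable at x"
    "\<forall>\<^sub>F y in nhds x. invertible (e y) \<and> frame_metric (e y) = g y"
    by (rule ex_local_frame[OF twice_differentiableD(1)[OF twice[OF D(2)]] sym[OF D(2)] e0]) (rule that)
  obtain De where De: "(e has_derivative De) (at x)" using e(2) by (auto simp: differentiable_def)
  let ?s = "torsion_free_jet g e"
  let ?Ds = "\<lambda>h. (h, De h, \<chi> \<nu>. - (frechet_derivative (connection g \<nu>) (at x) h ** e x
     + connection g \<nu> x ** De h))"
  have s: "(?s has_derivative ?Ds) (at x)"
    by (rule torsion_free_jet_has_derivative[OF twice[OF D(2)] _ De]) (use metric D(2) in blast)
  have lift: "\<forall>\<^sub>F y in nhds x. ?s y \<in> T0 c \<and> jet1_frame_metric (?s y) = jet1 g y"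
    using e(3) eventually_nhds_in_open[OF D]
    by eventually_elim
      (blast intro: torsion_free_jet_in_T0[OF twice sym] jet1_frame_metric_torsion_free_jet[OF twice sym] D(1))
  then have s_T0: "\<forall>\<^sub>F y in nhds x. ?s y \<in> T0 c" by (auto elim: eventually_mono)
  have s_x: "?s x \<in> T0 c" "jet1_frame_metric (?s x) = jet1 g x"
    using eventually_nhds_x_imp_x[OF lift] by auto
  define ws where "ws = map ?Ds coordinate_vectors"
  have "(jet1_frame_metric has_derivative frechet_derivative jet1_frame_metric (at (?s x))) (at (?s x))"
    using differentiable_jet1_frame_metric by (simp add: frechet_derivative_works)
  from has_derivative_compose[OF s this]
  \<comment> \<open>Agreement of the projected lift with \<open>jet1 g\<close> on a whole
    neighbourhood transfers the derivative; agreement at \<open>x\<close> alone would not.\<close>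
  have "(jet1 g has_derivative (\<lambda>h. frechet_derivative jet1_frame_metric (at (?s x)) (?Ds h))) (at x)"
    by (rule has_derivative_transform_eventually)
      (use lift s_x in \<open>auto simp: eventually_at_filter elim: eventually_mono\<close>)
  then have "frechet_derivative (jet1 g) (at x) = (\<lambda>h. frechet_derivative jet1_frame_metric (at (?s x)) (?Ds h))"
    by (rule frechet_derivative_at[symmetric])
  then have "pullback (jet1 g) L x coordinate_vectors = pullback jet1_frame_metric L (?s x) ws"
    by (simp add: pullback_def ws_def s_x o_def)
  also have "\<dots> = sgn (det (frame_of (?s x))) * L_PG (?s x) ws"
  proof (rule L[OF s_x(1)])
    show "length ws = CARD('m)" by (simp add: ws_def length_coordinate_vectors)
    show "set ws \<subseteq> tangent_vectors (T0 c) (?s x)"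
      using tangent_vectors_image[OF s s_T0] by (auto simp: ws_def)
  qed
  also have "L_PG (?s x) ws = (\<Sum>\<sigma>\<in>UNIV. \<Sum>\<nu>\<in>UNIV. frame_metric (frame_of (?s x)) $ \<sigma> $ \<nu> *
      (\<Sum>\<rho>\<in>UNIV. curvature_matrix g \<rho> \<nu> x $ \<rho> $ \<sigma>)) * det (matrix_inv (frame_of (?s x)))"
  proof (rule L_PG_eq[where \<Gamma> = "\<lambda>\<sigma>. connection g \<sigma> x" and D\<Gamma> = "\<lambda>\<mu> \<nu>. pd \<mu> (connection g \<nu>) x"
        and De = "\<lambda>\<mu>. De (axis \<mu> 1)" and Dz = "\<lambda>\<mu>. snd (snd (?Ds (axis \<mu> 1)))"])
    show "invertible (frame_of (?s x))" by (simp add: torsion_free_jet_def e(1) e0(2))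
    show "length ws = CARD('m)" by (simp add: ws_def length_coordinate_vectors)
    show "ws ! a = (axis (idx a) 1, De (axis (idx a) 1), snd (snd (?Ds (axis (idx a) 1))))" if "a < CARD('m)" for a
      using that by (simp add: ws_def length_coordinate_vectors nth_coordinate_vectors)
  qed (simp_all add: torsion_free_jet_def pd_def curvature_matrix_def)
  also have "frame_of (?s x) = e0" by (simp add: torsion_free_jet_def e(1))
  also have "(\<Sum>\<sigma>\<in>UNIV. \<Sum>\<nu>\<in>UNIV. frame_metric e0 $ \<sigma> $ \<nu> *
      (\<Sum>\<rho>\<in>UNIV. curvature_matrix g \<rho> \<nu> x $ \<rho> $ \<sigma>)) = scalar_curvature g x"
    using scalar_curvature_eq[OF twice[OF D(2)]] metric[OF D(2)] by (simp add: e0(1))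
  \<comment> \<open>Since \<open>\<bar>det (g x)\<bar> = (det e0)\<^sup>2\<close>, the inverse of
    \<open>\<bar>det e0\<bar>\<close> is the metric density, whichever frame \<open>e0\<close> was
    chosen.\<close>
  also have "sgn (det e0) * (scalar_curvature g x * det (matrix_inv e0)) =
      scalar_curvature g x * sqrt \<bar>det (matrix_inv (g x))\<bar>"
  proof -
    have "det e0 \<noteq> 0" using e0(2) invertible_det_nz by blast
    then have "sgn (det e0) * det (matrix_inv e0) = inverse \<bar>det e0\<bar>"
      by (simp add: det_matrix_inv e0(2) sgn_if)
    also have "\<dots> = sqrt \<bar>det (matrix_inv (g x))\<bar>"
      by (simp add: e0 det_matrix_inv invertible_frame_metric abs_det_frame_metric abs_inverse
          real_sqrt_inverse)
    finally show ?thesis by (simp add: mult.left_commute)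
  qed
  finally show ?thesis .
qed

section \<open>Integration over compact sets of the manifold\<close>

lemma ex_chart_selection:
  assumes M: "smooth_manifold X A" and C: "compactin X C"
  shows "\<exists>\<kappa>. chart_selection A C \<kappa>"
proof -
  have chart: "openin X (fst c)" "open (chart_image c)"
    "homeomorphic_map (subtopology X (fst c)) (top_of_set (chart_image c)) (snd c)" if "c \<in> A" for c
    using M that unfolding smooth_manifold_def by auto
  have "\<Union> (fst ` A) = topspace X" "Hausdorff_space X"
    using M unfolding smooth_manifold_def by auto
  then have "C \<subseteq> \<Union> (fst ` A)" "closedin X C"
    by (simp_all add: compactin_subset_topspace[OF C] compactin_imp_closedin[OF _ C])
  then obtain F where F: "finite F" "F \<subseteq> fst ` A" "C \<subseteq> \<Union> F"
    using C chart(1) unfolding compactin_def by (metis (no_types, lifting) imageE)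
  then obtain B where B: "finite B" "B \<subseteq> A" "C \<subseteq> \<Union> (fst ` B)"
    by (metis finite_subset_image)
  obtain cs where cs: "set cs = B" using finite_list[OF B(1)] by blast
  \<comment> \<open>Each point gets the first chart of a finite cover, listed in some order, that
    contains it.\<close>
  define \<kappa> where "\<kappa> p = hd (filter (\<lambda>c. p \<in> fst c) cs)" for p
  have \<kappa>: "\<kappa> p \<in> B" "p \<in> fst (\<kappa> p)" if "p \<in> C" for p
  proof -
    have "filter (\<lambda>c. p \<in> fst c) cs \<noteq> []" using that B(3) cs by (auto simp: filter_empty_conv)
    then have "\<kappa> p \<in> set (filter (\<lambda>c. p \<in> fst c) cs)" unfolding \<kappa>_def by (rule hd_in_set)
    then show "\<kappa> p \<in> B" "p \<in> fst (\<kappa> p)" using cs by auto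
  qed
  have "snd c ` {p\<in>C. \<kappa> p = c} \<in> sets borel" if "c \<in> B" for c
  proof -
    obtain as bs where split: "cs = as @ c # bs" "c \<notin> set as"
      using split_list_first[of c cs] \<open>c \<in> B\<close> cs by blast
    have "c \<in> A" using that B by auto
    \<comment> \<open>\<open>as\<close> lists the charts before the first occurrence of
      \<open>c\<close>, and \<open>W\<close> is the part of the domain of \<open>c\<close> that they
      cover. The piece belonging to \<open>c\<close> is thus relatively closed minus open, and both
      images are Borel because the chart is a homeomorphism onto an open set.\<close>
    define W where "W = fst c \<inter> \<Union> (fst ` set as)"
    have eq: "{p\<in>C. \<kappa> p = c} = (C \<inter> fst c) - W"
    proof (intro set_eqI iffI)
      fix p assume "p \<in> {p\<in>C. \<kappa> p = c}"
      then have p: "p \<in> C" "\<kappa> p = c" by auto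
      have "p \<notin> fst d" if "d \<in> set as" for d
      proof
        assume "p \<in> fst d"
        then have "filter (\<lambda>c. p \<in> fst c) as \<noteq> []" using that by (auto simp: filter_empty_conv)
        then have "\<kappa> p \<in> set as" unfolding \<kappa>_def split(1)
          using hd_in_set[of "filter (\<lambda>c. p \<in> fst c) as"] by auto
        then show False using p split by simp
      qed
      then show "p \<in> (C \<inter> fst c) - W" using p \<kappa>[OF p(1)] by (auto simp: W_def)
    next
      fix p assume p: "p \<in> (C \<inter> fst c) - W"
      then have "filter (\<lambda>c. p \<in> fst c) as = []" by (auto simp: W_def filter_empty_conv)
      then show "p \<in> {p\<in>C. \<kappa> p = c}" using p by (simp add: \<kappa>_def split(1))
    qed
    let ?X = "subtopology X (fst c)" and ?Y = "top_of_set (chart_image c)"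
    have hom: "homeomorphic_map ?X ?Y (snd c)" by (rule chart(3)[OF \<open>c \<in> A\<close>])
    have top: "topspace ?X = fst c"
      using openin_subset[OF chart(1)[OF \<open>c \<in> A\<close>]] by (auto simp: topspace_subtopology)
    have "closedin ?X (C \<inter> fst c)"
      using \<open>closedin X C\<close> by (auto simp: closedin_subtopology)
    then have "closedin ?Y (snd c ` (C \<inter> fst c))"
      using homeomorphic_imp_closed_map[OF hom] by (simp add: closed_map_def)
    then have 1: "snd c ` (C \<inter> fst c) \<in> sets borel"
      using borel_open[OF chart(2)[OF \<open>c \<in> A\<close>]] by (auto simp: closedin_closed)
    have "openin X (\<Union> (fst ` set as))"
      using chart(1) B(2) cs split(1) by (intro openin_Union) auto
    then have "openin ?X W" by (auto simp: W_def openin_subtopology)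
    then have "openin ?Y (snd c ` W)"
      using homeomorphic_imp_open_map[OF hom] by (simp add: open_map_def)
    then have 2: "snd c ` W \<in> sets borel"
      using chart(2)[OF \<open>c \<in> A\<close>] by (metis borel_open openin_open_eq)
    have "inj_on (snd c) (fst c)"
      using homeomorphic_imp_injective_map[OF hom] top by simp
    then have "snd c ` ((C \<inter> fst c) - W) = snd c ` (C \<inter> fst c) - snd c ` W"
      by (rule inj_on_image_set_diff) (auto simp: W_def)
    then show ?thesis unfolding eq using 1 2 by (simp add: sets.Diff)
  qed
  moreover have "\<kappa> ` C \<subseteq> B" using \<kappa> by auto
  ultimately have "chart_selection A C \<kappa>"
    unfolding chart_selection_def using \<kappa> B by (auto intro: finite_subset)
  then show ?thesis by blast
qed

text \<open>Both integrals use the same choice of \<kappa>. Existence of a selection ensures that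
  the chosen \<kappa> has its pieces inside chart domains, where the integrands agree; integrability
  is not at issue, since equal integrands have equal integrals.\<close>

lemma integral_odd_form_cong:
  assumes "smooth_manifold X A" "compactin X C"
    and eq: "\<And>c x. c \<in> A \<Longrightarrow> x \<in> chart_image c \<Longrightarrow> \<alpha> c x coordinate_vectors = \<beta> c x coordinate_vectors"
  shows "integral_odd_form A C \<alpha> = integral_odd_form A C \<beta>"
proof -
  define \<kappa> where "\<kappa> = (SOME \<kappa>. chart_selection A C \<kappa>)"
  have \<kappa>: "chart_selection A C \<kappa>"
    unfolding \<kappa>_def by (rule someI_ex[OF ex_chart_selection[OF assms(1,2)]])
  show ?thesis
    unfolding integral_odd_form_def Let_def \<kappa>_def[symmetric] coordinate_vectors_def[symmetric]
      set_lebesgue_integral_def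
  proof (intro sum.cong refl Bochner_Integration.integral_cong)
    fix c x assume "c \<in> \<kappa> ` C"
    then have "c \<in> A" and "snd c ` {p\<in>C. \<kappa> p = c} \<subseteq> chart_image c"
      using \<kappa> unfolding chart_selection_def chart_image_def by auto
    then show "indicat_real (snd c ` {p\<in>C. \<kappa> p = c}) x *\<^sub>R \<alpha> c x coordinate_vectors =
        indicat_real (snd c ` {p\<in>C. \<kappa> p = c}) x *\<^sub>R \<beta> c x coordinate_vectors"
      by (cases "x \<in> snd c ` {p\<in>C. \<kappa> p = c}") (auto simp: eq)
  qed
qed

lemma lagrangian_action_eq:
  fixes A :: "('a, 'm::{finite,linorder}) chart set"
  assumes M: "smooth_manifold X A" and L: "is_L_EH1 A L" and C: "compactin X C" and g: "metric_section A g"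
  shows "lagrangian_action A jet2 (\<lambda>c. L_EH) C g = lagrangian_action A jet1 L C g"
  unfolding lagrangian_action_def
proof (rule integral_odd_form_cong[OF M C])
  fix c x assume c: "c \<in> A" "x \<in> chart_image c"
  have op: "open (chart_image c)" using M c(1) unfolding smooth_manifold_def by auto
  have g: "smooth_on (chart_image c) (g c)" "g c ` chart_image c \<subseteq> metrics"
    using g c(1) unfolding metric_section_def by auto
  then have "invertible (g c x)"
    using c(2) by (auto simp: metrics_def frames_def invertible_frame_metric)
  moreover have "pullback (jet1 (g c)) (L c) x coordinate_vectors =
      scalar_curvature (g c) x * sqrt \<bar>det (matrix_inv (g c x))\<bar>"
    by (rule pullback_L_EH1[OF op c(2) g]) (use L c(1) in \<open>auto simp: is_L_EH1_def\<close>)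
  ultimately show "pullback (jet2 (g c)) L_EH x coordinate_vectors = pullback (jet1 (g c)) (L c) x coordinate_vectors"
    using pullback_L_EH[OF op c(2) g(1)] by simp
qed

theorem corollary8p4:
  fixes X :: "'a topology"
    and A :: "('a, 'm::{finite,linorder}) chart set"
    and L_EH1 :: "('a, 'm) chart \<Rightarrow> ('m mat, 'm) j1 form"
  assumes "smooth_manifold X A"
    and "is_L_EH1 A L_EH1"
  shows "extremals X A jet2 (\<lambda>c. L_EH) = extremals X A jet1 L_EH1"
proof -
  have "((\<lambda>t. lagrangian_action A jet2 (\<lambda>c. L_EH) C (G t)) has_real_derivative 0) (at 0) \<longleftrightarrow>
      ((\<lambda>t. lagrangian_action A jet1 L_EH1 C (G t)) has_real_derivative 0) (at 0)"
    if "compactin X C" "smooth_variation A C g \<epsilon> G" for C g \<epsilon> G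
  proof (rule DERIV_cong_ev)
    \<comment> \<open>The members of a variation are metric sections only for parameters in this
      interval. It is a neighbourhood of 0, so the two actions agree where the derivative at 0 sees
      them.\<close>
    have "\<epsilon> > 0" and sec: "\<And>t. t \<in> {-\<epsilon><..<\<epsilon>} \<Longrightarrow> metric_section A (G t)"
      using that(2) unfolding smooth_variation_def by auto
    then have "\<forall>\<^sub>F t in nhds 0. t \<in> {-\<epsilon><..<\<epsilon>}"
      by (intro eventually_nhds_in_open) auto
    then show "\<forall>\<^sub>F t in nhds 0. lagrangian_action A jet2 (\<lambda>c. L_EH) C (G t) = lagrangian_action A jet1 L_EH1 C (G t)"
      by (rule eventually_mono) (rule lagrangian_action_eq[OF assms that(1) sec])
  qed simp_all
  then show ?thesis unfolding extremals_def by blast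
qed

end
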